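(* The following formula is valid (as an identity of power series in $\xi$ at $\xi=0$, for $\tau\in\mathbb H_1$ and $z\in\mathbb C\setminus(\mathbb Z\tau+\mathbb Z)$): $$\exp\Bigl(-4\pi^2G_2(\tau)\,\xi^2-\frac{\vartheta_z(\tau,z)}{\vartheta(\tau,z)}\,\xi\Bigr)\,\vartheta(\tau,z+\xi)=\vartheta(\tau,z)\,\exp\Bigl(-\sum_{n\ge2}\wp^{(n-2)}(\tau,z)\,\frac{\xi^n}{n!}\Bigr),$$ where $\wp^{(n)}(\tau,z)=\dfrac{\partial^n}{\partial z^n}\wp(\tau,z)$.
   Context: $\mathbb H_1$ is the upper half-plane, $q=e^{2\pi i\tau}$, $y=e^{2\pi iz}$, $q^a=e^{2\pi i a\tau}$, $y^a=e^{2\pi i az}$. $$\vartheta(\tau,z)=\sum_{n\equiv 1\,\mathrm{mod}\,2}(-1)^{\frac{n-1}{2}}q^{n^2/8}y^{n/2}=-q^{1/8}y^{-1/2}\prod_{n\ge1}(1-q^{n-1}y)(1-q^ny^{-1})(1-q^n),$$ $\vartheta_z=\partial\vartheta/\partial z$; $G_2(\tau)=-\frac1{24}+\sum_{n\ge1}\sigma_1(n)q^n$ with $\sigma_1(n)$ the sum of the positive divisors of $n$; and $$\wp(\tau,z)=z^{-2}+\sum_{\omega\in\mathbb Z\tau+\mathbb Z,\ \omega\ne0}\bigl((z+\omega)^{-2}-\omega^{-2}\bigr)$$ is the Weierstrass function. *)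

theory Defs
  imports "HOL-Complex_Analysis.Complex_Analysis"
begin

text \<open>The power \<open>q\<^sup>a\<close> of \<open>q = e(\<tau>)\<close> and the power \<open>y\<^sup>a\<close> of \<open>y = e(z)\<close>, where \<open>e(w) = exp (2 \<pi> \<i> w)\<close>,
  are understood as \<open>exp (2 \<pi> \<i> a \<tau>)\<close> and \<open>exp (2 \<pi> \<i> a z)\<close>; no branch of \<open>powr\<close> is involved.\<close>

definition epow :: "complex \<Rightarrow> complex \<Rightarrow> complex" where
  "epow w a = exp (2 * of_real pi * \<i> * a * w)"

text \<open>Sums over infinite index sets are written with \<^const>\<open>infsum\<close>; all of those below converge
  absolutely for \<open>Im \<tau> > 0\<close> (and, for the Weierstrass function, \<open>z\<close> outside the lattice).\<close>

definition theta :: "complex \<Rightarrow> complex \<Rightarrow> complex" where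
  "theta \<tau> z = (\<Sum>\<^sub>\<infinity>n\<in>{n::int. odd n}.
     (-1) powi ((n - 1) div 2) * epow \<tau> (of_int n ^ 2 / 8) * epow z (of_int n / 2))"

definition theta_z :: "complex \<Rightarrow> complex \<Rightarrow> complex" where
  "theta_z \<tau> z = deriv (theta \<tau>) z"

definition sigma1 :: "nat \<Rightarrow> nat" where
  "sigma1 n = (\<Sum>d | d dvd n. d)"

definition G2 :: "complex \<Rightarrow> complex" where
  "G2 \<tau> = - 1 / 24 + (\<Sum>\<^sub>\<infinity>n\<in>{1::nat..}. of_nat (sigma1 n) * epow \<tau> (of_nat n))"

definition period_lattice :: "complex \<Rightarrow> complex set" where
  "period_lattice \<tau> = {of_int m * \<tau> + of_int n | m n :: int. True}"

definition wp :: "complex \<Rightarrow> complex \<Rightarrow> complex" where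
  "wp \<tau> z = 1 / z ^ 2 + (\<Sum>\<^sub>\<infinity>\<omega>\<in>period_lattice \<tau> - {0}. 1 / (z + \<omega>) ^ 2 - 1 / \<omega> ^ 2)"

text \<open>The formal exponential of a power series; meaningful only if the constant term is \<open>0\<close>.\<close>

definition fps_exp_of :: "complex fps \<Rightarrow> complex fps" where
  "fps_exp_of F = fps_exp 1 oo F"

end

theory Submission
  imports Defs
begin

text \<open>Both sides have constant term \<open>\<vartheta>(\<tau>, z)\<close>, so it suffices that their logarithmic derivatives in \<open>\<xi>\<close>
  agree; differentiating once more, this is \<open>(\<vartheta>\<^sub>z / \<vartheta>)' = 8 \<pi>\<^sup>2 G\<^sub>2 - \<wp>\<close> off the lattice. By the finite
  \<open>q\<close>-binomial theorem and dominated convergence, \<open>\<vartheta>\<close> is \<open>y\<^bsup>-1/2\<^esup>\<close> times a constant times the locally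
  uniform limit of \<open>\<Prod>\<^bsub>j < N\<^esub> (1 - q\<^sup>j y) (1 - q\<^bsup>j+1\<^esup> y\<^sup>-\<^sup>1)\<close>, whence
  \<open>(\<vartheta>\<^sub>z / \<vartheta>)' = - \<Sum>\<^sub>m \<pi>\<^sup>2 / sin\<^sup>2 (\<pi> (z + m \<tau>))\<close>. On the other side, \<open>\<wp>\<close> converges absolutely, so it can be
  summed along the rows \<open>m \<tau> + \<int>\<close> of the lattice by \<open>\<Sum>\<^sub>n (w + n)\<^sup>-\<^sup>2 = \<pi>\<^sup>2 / sin\<^sup>2 (\<pi> w)\<close>, and the
  constants \<open>\<omega>\<^sup>-\<^sup>2\<close> add up to \<open>- 8 \<pi>\<^sup>2 G\<^sub>2\<close>.\<close>

section \<open>The finite triple product\<close>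

lemma epow_add: "epow w (a + b) = epow w a * epow w b"
  by (simp add: epow_def distrib_left distrib_right exp_add)

lemma epow_0 [simp]: "epow w 0 = 1"
  by (simp add: epow_def)

lemma epow_nonzero [simp]: "epow w a \<noteq> 0"
  by (simp add: epow_def)

lemma epow_minus: "epow w (- a) = inverse (epow w a)"
  by (simp add: epow_def exp_minus)

lemma epow_power: "epow w a ^ n = epow w (of_nat n * a)"
  by (simp add: epow_def exp_of_nat_mult [symmetric] mult_ac)

lemma epow_eq_1_iff: "epow w 1 = 1 \<longleftrightarrow> w \<in> \<int>"
proof -
  have "epow w 1 = 1 \<longleftrightarrow> (\<exists>n::int. w = of_int n)"
    unfolding epow_def exp_eq_1
    by (auto simp: complex_eq_iff)
  thus ?thesis by (auto simp: Ints_def)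
qed

lemma norm_epow_less_1: "Im \<tau> > 0 \<Longrightarrow> norm (epow \<tau> 1) < 1"
  by (simp add: epow_def norm_exp_eq_Re)

section \<open>The q-Pochhammer symbol \<open>(q; q)_n\<close>, Gaussian binomials and the
  q-binomial theorem\<close>

definition qpoch :: "'a :: field \<Rightarrow> nat \<Rightarrow> 'a" where
  "qpoch q n = (\<Prod>i<n. 1 - q ^ Suc i)"

text \<open>The Gaussian binomial coefficient. Its value \<open>0\<close> for \<open>k > n\<close>
  lets the Pascal rule run up to \<open>k = n\<close> and removes the extra top term in the proof of
  the q-binomial theorem.\<close>

definition qbinom :: "'a :: field \<Rightarrow> nat \<Rightarrow> nat \<Rightarrow> 'a" where
  "qbinom q n k = (if k \<le> n then qpoch q n / (qpoch q k * qpoch q (n - k)) else 0)"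

lemma qpoch_0 [simp]: "qpoch q 0 = 1"
  by (simp add: qpoch_def)

lemma qpoch_Suc: "qpoch q (Suc n) = qpoch q n * (1 - q ^ Suc n)"
  by (simp add: qpoch_def)

lemma qpoch_nonzero:
  fixes q :: "'a :: real_normed_field"
  assumes "norm q < 1"
  shows "qpoch q n \<noteq> 0"
proof -
  have "q ^ Suc i \<noteq> 1" for i
    using assms by (metis norm_ge_zero norm_one norm_power less_irrefl power_Suc_less_one
      zero_less_norm_iff power_0_Suc zero_neq_one)
  thus ?thesis by (simp add: qpoch_def)
qed

text \<open>One of the two q-Pascal rules. Below the edge \<open>k = n\<close>, the common
  denominator \<open>(q; q)_(k+1) (q; q)_(n-k)\<close> reduces it to
  \<open>1 - q^(n+1) = (1 - q^(n-k)) + q^(n-k) (1 - q^(k+1))\<close>.\<close>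

lemma qbinom_Suc_Suc:
  fixes q :: "'a :: real_normed_field"
  assumes "norm q < 1" "k \<le> n"
  shows "qbinom q (Suc n) (Suc k) = qbinom q n (Suc k) + q ^ (n - k) * qbinom q n k"
proof (cases "k = n")
  case True
  thus ?thesis using qpoch_nonzero[OF assms(1)] by (simp add: qbinom_def)
next
  case False
  define d where "d = n - Suc k"
  have n: "n = Suc (k + d)" using False assms(2) by (simp add: d_def)
  have nz: "qpoch q i \<noteq> 0" for i by (rule qpoch_nonzero[OF assms(1)])
  have nz1: "1 - q ^ Suc i \<noteq> 0" for i using nz[of "Suc i"] by (simp add: qpoch_Suc)
  have e: "qbinom q n (Suc k) = qpoch q n * (1 - q ^ Suc d) / (qpoch q (Suc k) * qpoch q (Suc d))"
    using nz nz1[of d] by (simp add: qbinom_def n qpoch_Suc del: power_Suc)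
  have f: "q ^ (n - k) * qbinom q n k
     = qpoch q n * (1 - q ^ Suc k) * q ^ Suc d / (qpoch q (Suc k) * qpoch q (Suc d))"
    using nz nz1[of k] by (simp add: qbinom_def n qpoch_Suc del: power_Suc)
  have g: "qbinom q (Suc n) (Suc k) = qpoch q n * (1 - q ^ Suc n) / (qpoch q (Suc k) * qpoch q (Suc d))"
    by (simp add: qbinom_def n qpoch_Suc[of q "Suc (k+d)"] del: power_Suc)
  show ?thesis
    unfolding e f g by (simp add: add_divide_distrib [symmetric] n power_add algebra_simps)
qed

text \<open>The Pascal rule matches multiplication by the new factor \<open>1 + q^n x\<close>: the
  increment \<open>k\<close> of the triangular exponent turns its weight \<open>q^(n-k)\<close> into
  \<open>q^n\<close>.\<close>

theorem q_binomial:
  fixes q :: "'a :: real_normed_field"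
  assumes "norm q < 1"
  shows "(\<Prod>i<n. 1 + q ^ i * x) = (\<Sum>k\<le>n. q ^ (k choose 2) * qbinom q n k * x ^ k)"
proof (induction n)
  case 0
  thus ?case by (simp add: qbinom_def numeral_2_eq_2)
next
  case (Suc n)
  let ?t = "\<lambda>n k. q ^ (k choose 2) * qbinom q n k * x ^ k"
  have z: "?t m 0 = 1" for m using qpoch_nonzero[OF assms] by (simp add: qbinom_def numeral_2_eq_2)
  have step: "?t (Suc n) (Suc k) = ?t n (Suc k) + q ^ n * x * ?t n k" if "k \<le> n" for k
  proof -
    have "Suc k choose 2 = k + (k choose 2)" by (simp add: numeral_2_eq_2)
    moreover have "q ^ n = q ^ k * q ^ (n - k)" using that by (simp flip: power_add)
    ultimately show ?thesis
      unfolding qbinom_Suc_Suc[OF assms that] by (simp add: power_add algebra_simps)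
  qed
  have "(\<Sum>k\<le>Suc n. ?t (Suc n) k) = 1 + (\<Sum>k\<le>n. ?t (Suc n) (Suc k))"
    by (subst sum.atMost_Suc_shift) (simp only: z)
  also have "\<dots> = 1 + (\<Sum>k\<le>n. ?t n (Suc k)) + q ^ n * x * (\<Sum>k\<le>n. ?t n k)"
    unfolding sum_distrib_left add.assoc sum.distrib [symmetric]
    by (intro arg_cong2[of _ _ _ _ "(+)"] sum.cong refl step) auto
  also have "1 + (\<Sum>k\<le>n. ?t n (Suc k)) = (\<Sum>k\<le>Suc n. ?t n k)"
    by (subst sum.atMost_Suc_shift) (simp only: z)
  also have "\<dots> = (\<Sum>k\<le>n. ?t n k)"
    by (simp add: qbinom_def)
  finally show ?case
    using Suc.IH by (simp add: algebra_simps)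
qed

text \<open>Partial products of the Jacobi triple product. The factors \<open>1 - q^n\<close> are
  left out: they do not depend on \<open>z\<close> and only affect the limit by a nonzero
  constant.\<close>

definition qprod :: "complex \<Rightarrow> nat \<Rightarrow> complex \<Rightarrow> complex" where
  "qprod \<tau> N z = (\<Prod>j<N. (1 - epow \<tau> (of_nat j) * epow z 1) * (1 - epow \<tau> (of_nat (Suc j)) * epow z (-1)))"

text \<open>The theta series at \<open>n = 2 m - 1\<close>, with the factor
  \<open>- q^(1/8) y^(-1/2)\<close> taken out.\<close>

definition theta_term :: "complex \<Rightarrow> complex \<Rightarrow> int \<Rightarrow> complex" where
  "theta_term \<tau> z m = (-1) powi m * epow \<tau> (of_int m * (of_int m - 1) / 2) * epow z (of_int m)"

lemma of_nat_choose_two: "(of_nat (k choose 2) :: complex) = of_nat k * (of_nat k - 1) / 2"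
  by (induction k) (simp_all add: numeral_2_eq_2 field_simps)

lemma epow_of_nat: "epow w (of_nat n) = epow w 1 ^ n"
  by (simp add: epow_power)

lemma prod_lessThan_add:
  fixes f :: "nat \<Rightarrow> 'a :: comm_monoid_mult"
  shows "(\<Prod>i<m + n. f i) = (\<Prod>i<m. f i) * (\<Prod>i<n. f (m + i))"
  by (induction n) (simp_all add: mult.assoc)

text \<open>This is the q-binomial theorem with \<open>2 N\<close> factors at
  \<open>x = - y q^(-N)\<close>. The factors with negative exponent are turned around by
  \<open>1 - q^(-j) y = - q^(-j) y (1 - q^j y^(-1))\<close>.\<close>

lemma finite_triple_product:
  assumes "Im \<tau> > 0"
  shows "qprod \<tau> N z = (\<Sum>k\<le>2*N. qbinom (epow \<tau> 1) (2*N) k * theta_term \<tau> z (int k - int N))"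
proof -
  define q where "q = epow \<tau> 1"
  define y where "y = epow z 1"
  define x where "x = - y * epow \<tau> (- of_nat N)"
  \<comment> \<open>The product of the monomials \<open>- q^(-j) y\<close> for
    \<open>1 \<le> j \<le> N\<close> that the turning around releases; \<open>A\<close> evaluates
    it.\<close>
  define c where "c = (-1) ^ N * epow z (of_nat N) * epow \<tau> (- (of_nat N * (of_nat N + 1) / 2))"
  have q: "norm q < 1" using norm_epow_less_1[OF assms] by (simp add: q_def)
  have cnz: "c \<noteq> 0" by (simp add: c_def)
  have A: "(\<Prod>j<N. - epow \<tau> (- of_nat (Suc j)) * y)
        = (-1) ^ N * epow z (of_nat N) * epow \<tau> (- (of_nat N * (of_nat N + 1) / 2))"
  proof (induction N)
    case (Suc N)
    have *: "- (of_nat (Suc N) * (of_nat (Suc N) + 1) / 2)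
         = - (of_nat N * (of_nat N + 1) / 2) + - (of_nat (Suc N) :: complex)"
      by (simp add: field_simps)
    have "epow z (of_nat (Suc N)) = epow z (of_nat N) * y"
      by (simp add: y_def epow_add)
    thus ?case unfolding prod.lessThan_Suc Suc * epow_add
      by (simp del: of_nat_Suc)
  qed simp
  have "(\<Prod>i<2*N. 1 + q ^ i * x) = (\<Prod>i<N. 1 + q ^ i * x) * (\<Prod>j<N. 1 + q ^ (N + j) * x)"
    by (simp add: mult_2 prod_lessThan_add)
  also have "(\<Prod>j<N. 1 + q ^ (N + j) * x) = (\<Prod>j<N. 1 - epow \<tau> (of_nat j) * y)"
    by (intro prod.cong refl)
      (simp add: x_def q_def power_add epow_minus epow_of_nat [of \<tau>])
  \<comment> \<open>Reversing the order gives factor \<open>j\<close> the exponent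
    \<open>-(j + 1)\<close>, which pairs it with the second kind of factor in
    \<open>qprod\<close>.\<close>
  also have "(\<Prod>i<N. 1 + q ^ i * x) = (\<Prod>j<N. 1 + q ^ (N - Suc j) * x)"
    by (rule prod.nat_diff_reindex [symmetric])
  also have "\<dots> = (\<Prod>j<N. (- epow \<tau> (- of_nat (Suc j)) * y) * (1 - epow \<tau> (of_nat (Suc j)) * epow z (-1)))"
  proof (intro prod.cong refl)
    fix j assume j: "j \<in> {..<N}"
    have "q ^ N = q ^ (N - Suc j) * q ^ Suc j" using j by (simp flip: power_add del: power_Suc)
    moreover have "q \<noteq> 0" "y \<noteq> 0" by (simp_all add: q_def y_def)
    ultimately show "1 + q ^ (N - Suc j) * x
       = (- epow \<tau> (- of_nat (Suc j)) * y) * (1 - epow \<tau> (of_nat (Suc j)) * epow z (-1))"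
      unfolding x_def epow_minus epow_of_nat q_def [symmetric] y_def [symmetric]
      by (simp add: field_simps)
  qed
  also have "\<dots> = c * (\<Prod>j<N. 1 - epow \<tau> (of_nat (Suc j)) * epow z (-1))"
    by (subst prod.distrib) (simp only: A c_def)
  finally have L: "(\<Prod>i<2*N. 1 + q ^ i * x) = c * qprod \<tau> N z"
    by (simp add: qprod_def prod.distrib y_def)
  have "q ^ (k choose 2) * qbinom q (2*N) k * x ^ k
        = c * (qbinom q (2*N) k * theta_term \<tau> z (int k - int N))" for k
  proof -
    define m where "m = int k - int N"
    have k: "(of_nat k :: complex) = of_nat N + of_int m" by (simp add: m_def)
    have "(-1 :: complex) ^ k = (-1) powi (int N + m)" by (simp add: m_def)
    hence sign: "(-1 :: complex) ^ k = (-1) ^ N * (-1) powi m" by (subst (asm) power_int_add) auto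
    have "x ^ k = (-1) ^ k * epow z (of_nat k) * epow \<tau> (of_nat k * - of_nat N)"
      unfolding x_def y_def by (simp only: power_mult_distrib epow_power power_minus[of "epow z 1"] mult_1_right)
    hence "q ^ (k choose 2) * x ^ k
        = (-1) ^ k * epow z (of_nat k) * epow \<tau> (of_nat (k choose 2) + of_nat k * - of_nat N)"
      unfolding epow_add by (simp add: q_def epow_power)
    \<comment> \<open>Completing the square around \<open>k = N\<close>: the part free of
      \<open>m\<close> is exactly the exponent of \<open>q\<close> in \<open>c\<close>.\<close>
    also have "of_nat (k choose 2) + of_nat k * - of_nat N
        = - (of_nat N * (of_nat N + 1) / 2) + of_int m * (of_int m - 1 :: complex) / 2"
      unfolding of_nat_choose_two k by (simp add: field_simps)
    finally have "q ^ (k choose 2) * x ^ k = c * theta_term \<tau> z m"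
      unfolding c_def theta_term_def epow_add sign k by (simp only: mult_ac)
    thus ?thesis by (simp add: m_def mult_ac)
  qed
  with q_binomial[OF q, of x "2*N"] L have "c * qprod \<tau> N z
     = c * (\<Sum>k\<le>2*N. qbinom q (2*N) k * theta_term \<tau> z (int k - int N))"
    by (simp add: sum_distrib_left)
  with cnz show ?thesis by (simp add: q_def)
qed

section \<open>Row sums of the Weierstrass function\<close>

lemma has_sum_int:
  fixes f :: "int \<Rightarrow> 'a :: {real_normed_vector}"
  assumes "((\<lambda>n::nat. f (int n)) has_sum a) UNIV" "((\<lambda>n::nat. f (- int (Suc n))) has_sum b) UNIV"
  shows "(f has_sum (a + b)) UNIV"
proof -
  have "(f has_sum a) {0..} \<longleftrightarrow> ((\<lambda>n::nat. f (int n)) has_sum a) UNIV"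
    by (rule has_sum_reindex_bij_witness[of _ int nat]) auto
  moreover have "(f has_sum b) {..<0} \<longleftrightarrow> ((\<lambda>n::nat. f (- int (Suc n))) has_sum b) UNIV"
    by (rule has_sum_reindex_bij_witness[of _ "\<lambda>n. - int (Suc n)" "\<lambda>k. nat (- k - 1)"]) auto
  ultimately have "(f has_sum (a + b)) ({0..} \<union> {..<0})"
    using assms by (intro has_sum_Un_disjoint) auto
  also have "{0::int..} \<union> {..<0} = UNIV" by auto
  finally show ?thesis .
qed

lemma summable_norm_inverse_square_shift:
  fixes w :: complex
  shows "summable (\<lambda>k. norm (1 / (w + of_nat k) ^ 2))"
proof (rule summable_comparison_test_ev)
  show "summable (\<lambda>k. 4 * (1 / real k ^ 2))"
    using inverse_power_summable[of 2, where 'a = real]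
    by (intro summable_mult) (simp add: inverse_eq_divide power_one_over)
  have "eventually (\<lambda>k. real k > max 0 (2 * norm w)) sequentially"
    using filterlim_real_sequentially by (rule filterlim_at_top_dense[THEN iffD1, rule_format])
  thus "eventually (\<lambda>k. norm (norm (1 / (w + of_nat k) ^ 2)) \<le> 4 * (1 / real k ^ 2)) sequentially"
  proof eventually_elim
    case (elim k)
    have "real k / 2 \<le> norm (of_nat k :: complex) - norm w" using elim by simp
    also have "\<dots> \<le> norm (w + of_nat k)" by (metis norm_diff_ineq add.commute)
    finally have "(real k / 2) ^ 2 \<le> norm (w + of_nat k) ^ 2" by (intro power_mono) auto
    moreover have "real k / 2 > 0" using elim by linarith
    ultimately have "1 / norm (w + of_nat k) ^ 2 \<le> 1 / (real k / 2) ^ 2"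
      by (intro divide_left_mono mult_pos_pos) (auto intro: less_le_trans zero_less_power)
    thus ?case using elim by (simp add: norm_divide norm_power power_divide)
  qed
qed

section \<open>Partial fractions of \<open>1 / sin^2\<close> by way of the trigamma function\<close>

lemma Polygamma_1_has_sum:
  fixes w :: complex
  assumes "w \<noteq> 0"
  shows "((\<lambda>k. 1 / (w + of_nat k) ^ 2) has_sum Polygamma 1 w) UNIV"
  using Polygamma_LIMSEQ[OF assms, of 1]
  by (intro norm_summable_imp_has_sum summable_norm_inverse_square_shift)
    (simp_all add: inverse_eq_divide numeral_2_eq_2)

text \<open>Two differentiations of the reflection formula
  \<open>rGamma t * rGamma (1 - t) = sin (pi t) / pi\<close>: the first gives Digamma and the
  cotangent, the second the claim.\<close>

lemma Polygamma_1_reflection: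
  fixes w :: complex
  assumes "w \<notin> \<int>"
  shows "Polygamma 1 w + Polygamma 1 (1 - w) = of_real pi ^ 2 / sin (of_real pi * w) ^ 2"
proof -
  let ?p = "of_real pi :: complex"
  have nz: "sin (?p * t) \<noteq> 0" if "t \<notin> \<int>" for t
  proof
    assume "sin (?p * t) = 0"
    then obtain n :: int where "?p * t = of_real (of_int n * pi)" by (auto simp: sin_eq_0)
    hence "t = of_int n" by simp
    with that show False by simp
  qed
  have ni: "t \<notin> \<int>\<^sub>\<le>\<^sub>0" "1 - t \<notin> \<int>\<^sub>\<le>\<^sub>0" if "t \<notin> \<int>" for t :: complex
    using that by (auto elim!: nonpos_Ints_cases)
      (metis Ints_1 Ints_diff Ints_of_int add_diff_cancel_left' diff_diff_eq2 diff_add_cancel)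
  \<comment> \<open>The cotangent identity is available off the integers only; differentiating it at
    \<open>w\<close> requires it on a whole neighbourhood.\<close>
  have ev: "eventually (\<lambda>t. t \<notin> \<int>) (nhds w)"
    using assms closed_Ints[where 'a = complex] by (intro eventually_nhds_in_open[of "- \<int>", simplified]) auto
  have refl: "Digamma (1 - t) - Digamma t = ?p * cos (?p * t) / sin (?p * t)" if t: "t \<notin> \<int>" for t
  proof -
    have "((\<lambda>t. rGamma t * rGamma (1 - t)) has_field_derivative
            rGamma t * (rGamma (1 - t) * Digamma (1 - t)) - rGamma t * Digamma t * rGamma (1 - t)) (at t)"
      using ni[OF t] by (auto intro!: derivative_eq_intros)
    moreover have "((\<lambda>t. rGamma t * rGamma (1 - t)) has_field_derivative cos (?p * t)) (at t)"
      unfolding rGamma_reflection_complex by (auto intro!: derivative_eq_intros)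
    ultimately have "rGamma t * rGamma (1 - t) * (Digamma (1 - t) - Digamma t) = cos (?p * t)"
      by (auto dest: DERIV_unique simp: algebra_simps)
    thus ?thesis using nz[OF t] unfolding rGamma_reflection_complex by (simp add: field_simps)
  qed
  have "((\<lambda>t. Digamma (1 - t) - Digamma t) has_field_derivative
          (- Polygamma 1 (1 - w) - Polygamma 1 w)) (at w)"
    using ni[OF assms] by (auto intro!: derivative_eq_intros)
  moreover have "((\<lambda>t. ?p * cos (?p * t) / sin (?p * t)) has_field_derivative
      (- (?p ^ 2 / sin (?p * w) ^ 2))) (at w)"
  proof -
    let ?s = "sin (?p * w)" and ?c = "cos (?p * w)"
    have "((\<lambda>t. ?p * cos (?p * t) / sin (?p * t)) has_field_derivative
        (?p * (- (?s * ?p)) * ?s - ?p * ?c * (?c * ?p)) / (?s * ?s)) (at w)"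
      using nz[OF assms] by (auto intro!: derivative_eq_intros)
    also have "?p * (- (?s * ?p)) * ?s - ?p * ?c * (?c * ?p) = - (?p ^ 2 * (?s ^ 2 + ?c ^ 2))"
      by algebra
    also have "?s ^ 2 + ?c ^ 2 = 1" by (rule sin_cos_squared_add)
    finally show ?thesis by (simp add: power2_eq_square)
  qed
  moreover have "((\<lambda>t. Digamma (1 - t) - Digamma t) has_field_derivative D) (at w) \<longleftrightarrow>
      ((\<lambda>t. ?p * cos (?p * t) / sin (?p * t)) has_field_derivative D) (at w)" for D
    by (rule DERIV_cong_ev[OF HOL.refl _ HOL.refl]) (use ev in eventually_elim, rule refl)
  ultimately have "- Polygamma 1 (1 - w) - Polygamma 1 w = - (?p ^ 2 / sin (?p * w) ^ 2)"
    using DERIV_unique by blast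
  thus ?thesis by (simp add: algebra_simps)
qed

text \<open>The terms \<open>n \<ge> 0\<close> form the trigamma series at \<open>w\<close>. Those
  with \<open>n = -(k + 1)\<close> form the one at \<open>1 - w\<close>, because squaring removes
  the sign.\<close>

lemma has_sum_inverse_square_shift:
  fixes w :: complex
  assumes "w \<notin> \<int>"
  shows "((\<lambda>n::int. 1 / (w + of_int n) ^ 2) has_sum (of_real pi ^ 2 / sin (of_real pi * w) ^ 2)) UNIV"
  unfolding Polygamma_1_reflection[OF assms, symmetric]
proof (rule has_sum_int)
  have "w \<noteq> 0" "1 - w \<noteq> 0" using assms by auto
  show "((\<lambda>n. 1 / (w + of_int (int n))\<^sup>2) has_sum Polygamma 1 w) UNIV"
    using Polygamma_1_has_sum[OF \<open>w \<noteq> 0\<close>] by simp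
  have "(1 - w + of_nat n) ^ 2 = (w + of_int (- int (Suc n))) ^ 2" for n
    by (simp add: power2_eq_square algebra_simps)
  thus "((\<lambda>n. 1 / (w + of_int (- int (Suc n)))\<^sup>2) has_sum Polygamma 1 (1 - w)) UNIV"
    using Polygamma_1_has_sum[OF \<open>1 - w \<noteq> 0\<close>] by simp
qed

text \<open>The term at \<open>n = 0\<close> is \<open>1 / 0 = 0\<close>.\<close>

lemma has_sum_inverse_square_int:
  "((\<lambda>n::int. 1 / (of_int n :: complex) ^ 2) has_sum (of_real pi ^ 2 / 3)) UNIV"
proof -
  have "(\<lambda>n. of_real (1 / (real n + 1) ^ 2)) sums (of_real (pi ^ 2 / 6) :: complex)"
    by (intro sums_of_real) (use inverse_squares_sums in \<open>simp add: add_ac\<close>)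
  hence s: "(\<lambda>n. 1 / (1 + of_nat n) ^ 2) sums (of_real pi ^ 2 / 6 :: complex)"
    by (simp add: add_ac)
  have 1: "((\<lambda>n. 1 / (1 + of_nat n) ^ 2) has_sum (of_real pi ^ 2 / 6 :: complex)) UNIV"
    by (rule norm_summable_imp_has_sum[OF summable_norm_inverse_square_shift s])
  have "((\<lambda>n. 1 / (of_int (int n) :: complex) ^ 2) has_sum (of_real pi ^ 2 / 6)) UNIV"
  proof (rule norm_summable_imp_has_sum)
    show "summable (\<lambda>n. norm (1 / (of_int (int n) :: complex) ^ 2))"
      using summable_norm_inverse_square_shift[of 0] by simp
    show "(\<lambda>n. 1 / (of_int (int n) :: complex) ^ 2) sums (of_real pi ^ 2 / 6)"
      using sums_Suc[of "\<lambda>n. 1 / (of_int (int n) :: complex) ^ 2", of "of_real pi ^ 2 / 6"] s by simp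
  qed
  from has_sum_int[OF this, of "of_real pi ^ 2 / 6"] 1 show ?thesis
    by (simp add: power2_commute[of "-1"] power2_eq_square algebra_simps)
qed

lemma sin_pi_square: "sin (of_real pi * w) ^ 2 = - ((1 - epow w 1) ^ 2 / (4 * epow w 1))"
proof -
  define u where "u = exp (\<i> * (of_real pi * w))"
  have u: "u \<noteq> 0" "epow w 1 = u ^ 2" "exp (- (\<i> * (of_real pi * w))) = inverse u"
    by (simp_all add: u_def epow_def exp_minus algebra_simps flip: exp_double)
  show ?thesis unfolding u(2) sin_exp_eq u(3)
    unfolding u_def [symmetric] using u(1)
    by (simp add: field_simps power2_eq_square)
qed

text \<open>In this form the row sums can be compared both with the Lambert series of
  \<open>G2\<close> and with the factors of \<open>qprod\<close>. At integer \<open>w\<close> both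
  sides are \<open>0\<close> by division by zero.\<close>

lemma pi_square_over_sin_square:
  "of_real pi ^ 2 / sin (of_real pi * w) ^ 2 = - (4 * of_real pi ^ 2 * epow w 1 / (1 - epow w 1) ^ 2)"
  unfolding sin_pi_square by (simp add: field_simps)

section \<open>Absolute convergence of the lattice sum for \<open>wp\<close>\<close>

lemma lattice_norm_lower_bound:
  assumes "Im \<tau> > 0"
  obtains M where "M > 0" "\<And>x y. \<bar>x\<bar> + \<bar>y\<bar> \<le> M * norm (of_real x * \<tau> + of_real y)"
proof
  \<comment> \<open>The imaginary part gives \<open>\<bar>x\<bar> \<le> ?n / Im \<tau>\<close>, and
    the triangle inequality then gives
    \<open>\<bar>y\<bar> \<le> ?n + ?n * norm \<tau> / Im \<tau>\<close>; \<open>?M\<close> adds the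
    two bounds.\<close>
  let ?M = "1 + (1 + norm \<tau>) / Im \<tau>"
  show "?M > 0" using assms by (intro add_pos_nonneg divide_nonneg_pos) auto
  fix x y :: real
  let ?n = "norm (of_real x * \<tau> + of_real y)"
  have "\<bar>x * Im \<tau>\<bar> \<le> ?n" using abs_Im_le_cmod[of "of_real x * \<tau> + of_real y"] by simp
  hence 1: "\<bar>x\<bar> \<le> ?n / Im \<tau>" using assms by (simp add: abs_mult field_simps)
  have "\<bar>y\<bar> = norm ((of_real x * \<tau> + of_real y) - of_real x * \<tau>)" by simp
  also have "\<dots> \<le> ?n + norm (of_real x * \<tau>)" by (rule norm_triangle_ineq4)
  also have "\<dots> = ?n + \<bar>x\<bar> * norm \<tau>" by (simp add: norm_mult)
  also have "\<dots> \<le> ?n + ?n / Im \<tau> * norm \<tau>" using 1 by (intro add_left_mono mult_right_mono) auto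
  finally show "\<bar>x\<bar> + \<bar>y\<bar> \<le> ?M * ?n" using 1 assms by (simp add: field_simps)
qed

lemma bij_betw_period_lattice:
  assumes "Im \<tau> > 0"
  shows "bij_betw (\<lambda>(m, n). of_int m * \<tau> + of_int n) (UNIV :: (int \<times> int) set) (period_lattice \<tau>)"
proof -
  have "m = m' \<and> n = n'" if "of_int m * \<tau> + of_int n = of_int m' * \<tau> + of_int n'" for m n m' n'
  proof -
    obtain M where "M > 0" and M: "\<And>x y. \<bar>x\<bar> + \<bar>y\<bar> \<le> M * norm (of_real x * \<tau> + of_real y)"
      using lattice_norm_lower_bound[OF assms] by blast
    have "of_int (m - m') * \<tau> + of_int (n - n') = 0" using that by (simp add: algebra_simps)
    with M[of "of_int (m - m')" "of_int (n - n')"]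
    have "\<bar>real_of_int (m - m')\<bar> + \<bar>real_of_int (n - n')\<bar> \<le> 0" by simp
    hence "real_of_int (m - m') = 0 \<and> real_of_int (n - n') = 0" by linarith
    thus ?thesis by simp
  qed
  thus ?thesis
    unfolding bij_betw_def inj_on_def period_lattice_def by auto
qed

text \<open>The exponent is half of \<open>-3\<close>: a product of two such factors, one for each
  lattice coordinate, will dominate \<open>1 / norm \<omega> ^ 3\<close>.\<close>

lemma summable_on_int_powr: "(\<lambda>n::int. (1 + \<bar>of_int n\<bar>) powr (- (3 / 2)) :: real) summable_on UNIV"
proof -
  have *: "summable (\<lambda>n. real (Suc n) powr (- (3 / 2)))"
    by (subst summable_Suc_iff) (simp add: summable_real_powr_iff)
  hence **: "summable (\<lambda>n. real (Suc (Suc n)) powr (- (3 / 2)))"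
    by (subst summable_Suc_iff [of "\<lambda>n. real (Suc n) powr (- (3 / 2))"])
  obtain a b where "((\<lambda>n. real (Suc n) powr (- (3 / 2))) has_sum a) UNIV"
      "((\<lambda>n. real (Suc (Suc n)) powr (- (3 / 2))) has_sum b) UNIV"
    using summable_nonneg_imp_summable_on[OF *] summable_nonneg_imp_summable_on[OF **]
    by (auto simp: summable_on_def)
  hence "((\<lambda>n::int. (1 + \<bar>of_int n\<bar>) powr (- (3 / 2)) :: real) has_sum (a + b)) UNIV"
    by (intro has_sum_int) (simp_all add: add_ac)
  thus ?thesis by (auto simp: summable_on_def)
qed

lemma summable_on_product_nonneg:
  fixes f :: "'a \<Rightarrow> real" and g :: "'b \<Rightarrow> real"
  assumes "f summable_on A" "g summable_on B" "\<And>x. f x \<ge> 0" "\<And>y. g y \<ge> 0"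
  shows "(\<lambda>(x, y). f x * g y) summable_on (A \<times> B)"
proof (rule summable_on_SigmaI)
  fix x
  show "((\<lambda>y. (\<lambda>(x, y). f x * g y) (x, y)) has_sum (f x * infsum g B)) B"
    using assms(2) by (auto intro: has_sum_cmult_right)
qed (use assms in \<open>auto intro: summable_on_cmult_left\<close>)

lemma weierstrass_term_bound:
  fixes z \<omega> :: complex
  assumes "norm \<omega> \<ge> 2 * norm z" "\<omega> \<noteq> 0"
  shows "norm (1 / (z + \<omega>) ^ 2 - 1 / \<omega> ^ 2) \<le> 10 * norm z / norm \<omega> ^ 3"
proof -
  have "norm \<omega> - norm z \<le> norm (z + \<omega>)" by (metis norm_diff_ineq add.commute)
  hence h: "norm \<omega> / 2 \<le> norm (z + \<omega>)" using assms(1) by linarith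
  have wz: "norm \<omega> > 0" "z + \<omega> \<noteq> 0" using assms h by auto
  have "norm (1 / (z + \<omega>) ^ 2 - 1 / \<omega> ^ 2) = norm (- (z * (2 * \<omega> + z)) / ((z + \<omega>) ^ 2 * \<omega> ^ 2))"
  proof -
    have "1 * \<omega> ^ 2 - 1 * (z + \<omega>) ^ 2 = - (z * (2 * \<omega> + z))"
      by (simp add: power2_eq_square algebra_simps)
    thus ?thesis using wz assms by (subst diff_frac_eq) auto
  qed
  also have "\<dots> = norm z * norm (2 * \<omega> + z) / (norm (z + \<omega>) ^ 2 * norm \<omega> ^ 2)"
    by (simp add: norm_mult norm_divide norm_power)
  \<comment> \<open>As \<open>norm z\<close> is at most half of \<open>norm \<omega>\<close>, it
    adds at most \<open>1/2\<close> to the coefficient \<open>2\<close> above and at most halves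
    \<open>norm \<omega>\<close> below; \<open>5/2\<close> times \<open>4\<close> is the constant
    \<open>10\<close>.\<close>
  also have "\<dots> \<le> norm z * (5 / 2 * norm \<omega>) / ((norm \<omega> / 2) ^ 2 * norm \<omega> ^ 2)"
  proof (intro frac_le mult_left_mono mult_right_mono power_mono h)
    have "norm (2 * \<omega> + z) \<le> 2 * norm \<omega> + norm z" by (rule norm_triangle_le) (simp add: norm_mult)
    thus "norm (2 * \<omega> + z) \<le> 5 / 2 * norm \<omega>" using assms(1) by linarith
  qed (use wz in auto)
  also have "\<dots> = 10 * norm z / norm \<omega> ^ 3" using wz by (simp add: field_simps power2_eq_square power3_eq_cube)
  finally show ?thesis .
qed

text \<open>Outside a finite box the cubic bound applies, and
  \<open>(1 + a) (1 + b) \<le> (1 + a + b)^2\<close> splits it into a product of two summable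
  functions of one integer.\<close>

lemma weierstrass_summable_on:
  assumes "Im \<tau> > 0"
  shows "(\<lambda>(m :: int, n :: int). 1 / (z + (of_int m * \<tau> + of_int n)) ^ 2 - 1 / (of_int m * \<tau> + of_int n) ^ 2)
           summable_on UNIV"
    (is "?F summable_on _")
proof -
  obtain M where M0: "M > 0" and M: "\<And>x y. \<bar>x\<bar> + \<bar>y\<bar> \<le> M * norm (of_real x * \<tau> + of_real y)"
    using lattice_norm_lower_bound[OF assms] by blast
  define B where "B = \<lceil>2 * norm z * M\<rceil>"
  \<comment> \<open>The origin is inserted explicitly so that \<open>a + b \<ge> 1\<close> is
    immediate outside \<open>S\<close>.\<close>
  define S where "S = insert (0, 0) ({-B..B} \<times> {-B..B})"
  define g :: "int \<Rightarrow> real" where "g n = (1 + \<bar>of_int n\<bar>) powr (- (3 / 2))" for n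
  have g: "(\<lambda>(m, n). 10 * norm z * (2 * M) ^ 3 * (g m * g n)) summable_on UNIV"
    using summable_on_cmult_right[OF summable_on_product_nonneg[OF summable_on_int_powr summable_on_int_powr],
        of "10 * norm z * (2 * M) ^ 3"]
    by (simp add: g_def case_prod_unfold)
  have bound: "norm (?F (m, n)) \<le> 10 * norm z * (2 * M) ^ 3 * (g m * g n)" if mn: "(m, n) \<notin> S" for m n
  proof -
    define \<omega> where "\<omega> = of_int m * \<tau> + of_int n"
    define a b :: real where "a = \<bar>of_int m\<bar>" and "b = \<bar>of_int n\<bar>"
    have ab: "a + b \<le> M * norm \<omega>" using M[of "of_int m" "of_int n"] by (simp add: a_def b_def \<omega>_def)
    have ab1: "a + b \<ge> 1" "a \<ge> 0" "b \<ge> 0" using mn by (auto simp: S_def a_def b_def)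
    have "of_int B < a + b" using mn by (auto simp: S_def a_def b_def)
    hence "2 * norm z * M < a + b" unfolding B_def by linarith
    hence "2 * norm z * M < norm \<omega> * M" using ab by (simp add: mult.commute)
    hence z: "2 * norm z \<le> norm \<omega>" using M0 by simp
    have w: "\<omega> \<noteq> 0" using ab ab1 by auto
    have "(1 + a) * (1 + b) \<le> (1 + a + b) ^ 2"
      using ab1 by (simp add: power2_eq_square algebra_simps)
    hence "((1 + a) * (1 + b)) powr (3 / 2) \<le> ((1 + a + b) ^ 2) powr (3 / 2)"
      using ab1 by (intro powr_mono2) auto
    also have "((1 + a + b) ^ 2) powr (3 / 2) = (1 + a + b) powr 3"
    proof -
      have "(1 + a + b) ^ 2 = (1 + a + b) powr 2" using ab1 by simp
      thus ?thesis by (simp only: powr_powr) simp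
    qed
    also have "\<dots> = (1 + a + b) ^ 3" using ab1 by (subst powr_numeral) auto
    \<comment> \<open>From \<open>a + b \<ge> 1\<close> follows
      \<open>1 + a + b \<le> 2 (a + b)\<close>, hence the factor \<open>2\<close>.\<close>
    also have "\<dots> \<le> (2 * M * norm \<omega>) ^ 3" using ab ab1 by (intro power_mono) auto
    finally have "((1 + a) * (1 + b)) powr (3 / 2) \<le> (2 * M * norm \<omega>) ^ 3" .
    hence "1 / (2 * M * norm \<omega>) ^ 3 \<le> 1 / ((1 + a) * (1 + b)) powr (3 / 2)"
      using ab1 M0 w by (intro divide_left_mono mult_pos_pos) auto
    also have "\<dots> = g m * g n"
    proof -
      have "g m = 1 / (1 + a) powr (3 / 2)" "g n = 1 / (1 + b) powr (3 / 2)"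
        unfolding g_def a_def b_def by (rule powr_minus_divide)+
      thus ?thesis using ab1 by (simp add: powr_mult)
    qed
    finally have "1 / norm \<omega> ^ 3 \<le> (2 * M) ^ 3 * (g m * g n)"
      using M0 w by (simp add: power_mult_distrib pos_divide_le_eq mult_ac)
    hence "10 * norm z * (1 / norm \<omega> ^ 3) \<le> 10 * norm z * ((2 * M) ^ 3 * (g m * g n))"
      by (rule mult_left_mono) simp
    also have "\<dots> = 10 * norm z * (2 * M) ^ 3 * (g m * g n)" by (simp only: mult.assoc)
    finally show ?thesis
      using weierstrass_term_bound[OF z w] unfolding prod.case \<omega>_def [symmetric] by simp
  qed
  have "?F summable_on (- S)"
  proof (rule abs_summable_summable, rule Infinite_Sum.abs_summable_on_comparison_test')
    show "(\<lambda>(m, n). 10 * norm z * (2 * M) ^ 3 * (g m * g n)) summable_on (- S)"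
      by (rule summable_on_subset[OF g]) auto
    fix p assume p: "p \<in> - S"
    obtain m n where mn: "p = (m, n)" by (rule prod.exhaust)
    with p have "(m, n) \<notin> S" by simp
    from bound[OF this] show "norm (?F p) \<le> (\<lambda>(m, n). 10 * norm z * (2 * M) ^ 3 * (g m * g n)) p"
      unfolding mn prod.case .
  qed
  moreover have "?F summable_on S" by (rule summable_on_finite) (simp add: S_def)
  ultimately have "?F summable_on (- S \<union> S)" by (rule summable_on_union)
  thus ?thesis by simp
qed

text \<open>The term of the origin is \<open>1 / z\<^sup>2 - 1 / 0 = 1 / z\<^sup>2\<close>, which is the principal part of \<open>wp\<close>.\<close>

lemma wp_has_sum:
  assumes "Im \<tau> > 0"
  shows "((\<lambda>(m :: int, n :: int). 1 / (z + (of_int m * \<tau> + of_int n)) ^ 2 - 1 / (of_int m * \<tau> + of_int n) ^ 2)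
           has_sum wp \<tau> z) UNIV"
    (is "(?F has_sum _) _")
proof -
  let ?l = "\<lambda>(m :: int, n :: int). of_int m * \<tau> + of_int n"
  have bij: "bij_betw ?l (UNIV - {(0, 0)}) (period_lattice \<tau> - {0})"
  proof (rule bij_betw_subset[OF bij_betw_period_lattice[OF assms]])
    have "?l ` (UNIV - {(0, 0)}) = range ?l - ?l ` {(0, 0)}"
      using bij_betw_period_lattice[OF assms] by (intro inj_on_image_set_diff[of _ UNIV]) (auto simp: bij_betw_def)
    thus "?l ` (UNIV - {(0, 0)}) = period_lattice \<tau> - {0}"
      using bij_betw_period_lattice[OF assms] by (simp add: bij_betw_def)
  qed auto
  have "wp \<tau> z = 1 / z ^ 2 + (\<Sum>\<^sub>\<infinity>p\<in>UNIV - {(0, 0)}. 1 / (z + ?l p) ^ 2 - 1 / (?l p) ^ 2)"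
    unfolding wp_def infsum_reindex_bij_betw[OF bij, of "\<lambda>\<omega>. 1 / (z + \<omega>) ^ 2 - 1 / \<omega> ^ 2"] ..
  also have "(\<lambda>p. 1 / (z + ?l p) ^ 2 - 1 / (?l p) ^ 2) = ?F"
    by (simp add: fun_eq_iff case_prod_unfold)
  also have "1 / z ^ 2 + infsum ?F (UNIV - {(0, 0)}) = infsum ?F (insert (0, 0) (UNIV - {(0, 0)}))"
    by (subst infsum_insert) (auto intro: summable_on_subset[OF weierstrass_summable_on[OF assms]])
  also have "insert (0, 0) (UNIV - {(0, 0)}) = UNIV" by auto
  finally have "wp \<tau> z = infsum ?F UNIV" .
  thus ?thesis using has_sum_infsum[OF weierstrass_summable_on[OF assms]] by simp
qed

section \<open>Lambert series and Eisenstein summation\<close>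

lemma has_sum_atLeast_1_iff:
  fixes f :: "nat \<Rightarrow> 'a :: {comm_monoid_add, topological_space}"
  shows "(f has_sum s) {1..} \<longleftrightarrow> ((\<lambda>n. f (Suc n)) has_sum s) UNIV"
  by (rule has_sum_reindex_bij_witness[of _ Suc "\<lambda>n. n - 1"]) auto

lemma summable_of_nat_mult_power:
  fixes r :: real
  assumes "0 \<le> r" "r < 1"
  shows "summable (\<lambda>k. real k * r ^ k)"
proof -
  have "summable (\<lambda>n. r * (real (Suc n) * r ^ n))"
    using geometric_deriv_sums[of r] assms by (intro summable_mult) (auto simp: sums_iff)
  hence "summable (\<lambda>n. real (Suc n) * r ^ Suc n)" by (simp add: mult_ac)
  thus ?thesis by (subst (asm) summable_Suc_iff)
qed

lemma has_sum_of_nat_mult_power: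
  fixes x :: complex
  assumes "norm x < 1"
  shows "((\<lambda>k. of_nat k * x ^ k) has_sum (x / (1 - x) ^ 2)) {1..}"
  unfolding has_sum_atLeast_1_iff
proof (rule norm_summable_imp_has_sum)
  have "summable (\<lambda>k. real (Suc k) * norm x ^ Suc k)"
    using summable_of_nat_mult_power[of "norm x"] assms by (subst summable_Suc_iff) auto
  thus "summable (\<lambda>k. norm (of_nat (Suc k) * x ^ Suc k))"
    by (simp only: norm_mult norm_power norm_of_nat)
  show "(\<lambda>k. of_nat (Suc k) * x ^ Suc k) sums (x / (1 - x) ^ 2)"
    using sums_mult[OF geometric_deriv_sums[OF assms], of x] by (simp add: mult_ac)
qed

lemma lambert_summable_on:
  fixes q :: complex
  assumes "norm q < 1"
  shows "(\<lambda>(m, k). of_nat k * q ^ (m * k)) summable_on ({1..} \<times> {1..})"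
proof (rule abs_summable_summable, rule Infinite_Sum.abs_summable_on_comparison_test')
  let ?r = "norm q"
  have "summable (\<lambda>m. ?r ^ (m - 1))"
    using assms by (subst summable_Suc_iff [symmetric]) (simp add: summable_geometric)
  hence "(\<lambda>m. ?r ^ (m - 1)) summable_on UNIV"
    by (rule summable_nonneg_imp_summable_on) auto
  moreover have "(\<lambda>k. real k * ?r ^ k) summable_on UNIV"
    using summable_of_nat_mult_power[of ?r] assms by (intro summable_nonneg_imp_summable_on) auto
  ultimately have "(\<lambda>(m, k). ?r ^ (m - 1) * (real k * ?r ^ k)) summable_on (UNIV \<times> UNIV)"
    by (rule summable_on_product_nonneg) auto
  thus "(\<lambda>(m, k). ?r ^ (m - 1) * (real k * ?r ^ k)) summable_on ({1..} \<times> {1..})"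
    by (rule summable_on_subset) auto
  fix p :: "nat \<times> nat" assume p: "p \<in> {1..} \<times> {1..}"
  obtain m k where mk: "p = (Suc m, Suc k)" using p by (cases p) (auto simp: Suc_le_eq gr0_conv_Suc)
  \<comment> \<open>For positive integers the product of the indices is at least their sum minus
    one, which decouples them into a geometric series and an arithmetic-geometric one.\<close>
  have "?r ^ (Suc m * Suc k) \<le> ?r ^ (m + Suc k)"
    using assms by (intro power_decreasing) auto
  hence "real (Suc k) * ?r ^ (Suc m * Suc k) \<le> real (Suc k) * ?r ^ (m + Suc k)"
    by (intro mult_left_mono) auto
  thus "norm (case p of (m, k) \<Rightarrow> of_nat k * q ^ (m * k)) \<le> (case p of (m, k) \<Rightarrow> ?r ^ (m - 1) * (real k * ?r ^ k))"
    unfolding mk prod.case norm_mult norm_power norm_of_nat by (simp add: power_add mult_ac del: of_nat_Suc)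
qed

text \<open>The double series of \<open>k q^(m k)\<close> is summed in two ways: over
  \<open>k\<close> first, and over the divisors \<open>d = k\<close> of
  \<open>n = m k\<close>.\<close>

lemma lambert_series_sigma1:
  fixes q :: complex
  assumes "norm q < 1"
  shows "((\<lambda>m. q ^ m / (1 - q ^ m) ^ 2) has_sum (\<Sum>\<^sub>\<infinity>n\<in>{1..}. of_nat (sigma1 n) * q ^ n)) {1..}"
proof -
  define T where "T = infsum (\<lambda>(m, k). of_nat k * q ^ (m * k)) ({1..} \<times> {1..})"
  have T: "((\<lambda>(m, k). of_nat k * q ^ (m * k)) has_sum T) ({1..} \<times> {1..})"
    unfolding T_def by (rule has_sum_infsum[OF lambert_summable_on[OF assms]])
  have rows: "((\<lambda>m. q ^ m / (1 - q ^ m) ^ 2) has_sum T) {1..}"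
  proof (rule has_sum_Sigma'[OF T])
    fix m :: nat assume "m \<in> {1..}"
    hence "norm (q ^ m) < 1" using assms by (simp add: norm_power power_less_one_iff)
    from has_sum_of_nat_mult_power[OF this]
    show "((\<lambda>k. case (m, k) of (m, k) \<Rightarrow> of_nat k * q ^ (m * k)) has_sum (q ^ m / (1 - q ^ m) ^ 2)) {1..}"
      by (simp add: power_mult)
  qed
  have "((\<lambda>(n, d). of_nat d * q ^ n) has_sum T) (SIGMA n:{1..}. {d. d dvd n})
      \<longleftrightarrow> ((\<lambda>(m, k). of_nat k * q ^ (m * k)) has_sum T) ({1..} \<times> {1..})"
    by (rule has_sum_reindex_bij_witness[of _ "\<lambda>(m, k). (m * k, k)" "\<lambda>(n, d). (n div d, d)"])
      (auto simp: Suc_le_eq dvd_imp_le mult.commute elim!: dvdE)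
  hence "((\<lambda>(n, d). of_nat d * q ^ n) has_sum T) (SIGMA n:{1..}. {d. d dvd n})" using T by simp
  hence "((\<lambda>n. of_nat (sigma1 n) * q ^ n) has_sum T) {1..}"
  proof (rule has_sum_Sigma')
    fix n :: nat assume "n \<in> {1..}"
    thus "((\<lambda>d. case (n, d) of (n, d) \<Rightarrow> of_nat d * q ^ n) has_sum (of_nat (sigma1 n) * q ^ n)) {d. d dvd n}"
      by (intro has_sum_finiteI) (auto simp: sigma1_def sum_distrib_right)
  qed
  with rows show ?thesis by (simp add: infsumI)
qed

text \<open>Eisenstein summation of the series for \<open>1 / \<omega>\<^sup>2\<close>: the rows \<open>m \<noteq> 0\<close> produce the Lambert
  series of \<open>\<sigma>\<^sub>1\<close>, and the row \<open>m = 0\<close> the constant term of \<open>G\<^sub>2\<close>.\<close>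

lemma G2_has_sum:
  assumes "Im \<tau> > 0"
  shows "((\<lambda>m::int. if m = 0 then of_real pi ^ 2 / 3 else of_real pi ^ 2 / sin (of_real pi * (of_int m * \<tau>)) ^ 2)
           has_sum (- 8 * of_real pi ^ 2 * G2 \<tau>)) UNIV"
    (is "(?f has_sum _) _")
proof -
  define q where "q = epow \<tau> 1"
  define T where "T = (\<Sum>\<^sub>\<infinity>n\<in>{1..}. of_nat (sigma1 n) * q ^ n)"
  have q: "norm q < 1" using norm_epow_less_1[OF assms] by (simp add: q_def)
  have G2: "G2 \<tau> = - 1 / 24 + T"
    by (simp add: G2_def T_def q_def epow_of_nat)
  have "epow (of_int (int n) * \<tau>) 1 = q ^ n" for n
    by (simp add: q_def epow_power) (simp add: epow_def mult_ac)
  hence f: "?f (int n) = - 4 * of_real pi ^ 2 * (q ^ n / (1 - q ^ n) ^ 2)" if "n \<in> {1..}" for n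
    using that unfolding pi_square_over_sin_square by simp
  have "((\<lambda>n. ?f (int n)) has_sum (- 4 * of_real pi ^ 2 * T)) {1..}
    \<longleftrightarrow> ((\<lambda>n. - 4 * of_real pi ^ 2 * (q ^ n / (1 - q ^ n) ^ 2)) has_sum (- 4 * of_real pi ^ 2 * T)) {1..}"
    by (rule has_sum_cong) (rule f)
  hence *: "((\<lambda>n. ?f (int n)) has_sum (- 4 * of_real pi ^ 2 * T)) {1..}"
    using has_sum_cmult_right[OF lambert_series_sigma1[OF q]] by (simp only: T_def)
  have "((\<lambda>n. ?f (int n)) has_sum (?f (int 0) + - 4 * of_real pi ^ 2 * T)) (insert 0 {1..})"
    by (rule has_sum_insert[OF _ *]) auto
  also have "insert 0 {1..} = (UNIV :: nat set)" by auto
  finally have 1: "((\<lambda>n. ?f (int n)) has_sum (of_real pi ^ 2 / 3 + - 4 * of_real pi ^ 2 * T)) UNIV" by simp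
  have "?f (- int (Suc n)) = ?f (int (Suc n))" for n
    by (simp only: of_int_minus mult_minus_left mult_minus_right sin_minus power2_minus neg_equal_0_iff_equal)
  hence 2: "((\<lambda>n. ?f (- int (Suc n))) has_sum (- 4 * of_real pi ^ 2 * T)) UNIV"
    using * unfolding has_sum_atLeast_1_iff by presburger
  have "of_real pi ^ 2 / 3 + - 4 * of_real pi ^ 2 * T + - 4 * of_real pi ^ 2 * T = - 8 * of_real pi ^ 2 * G2 \<tau>"
    by (simp add: G2 field_simps)
  with has_sum_int[OF 1 2] show ?thesis by simp
qed

lemma period_lattice_not_Int:
  assumes "z \<notin> period_lattice \<tau>"
  shows "z + of_int m * \<tau> \<notin> \<int>"
proof
  assume "z + of_int m * \<tau> \<in> \<int>"
  then obtain n where "z + of_int m * \<tau> = of_int n" by (elim Ints_cases)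
  hence "z = of_int (- m) * \<tau> + of_int n" by (simp add: algebra_simps)
  with assms show False unfolding period_lattice_def by blast
qed

text \<open>Fubini is applied to the differences, which are absolutely summable over the whole
  lattice. The row sums \<open>g\<close> of the constants are added back only afterwards, through
  \<open>G2_has_sum\<close>.\<close>

lemma wp_row_sum:
  assumes "Im \<tau> > 0" "z \<notin> period_lattice \<tau>"
  shows "((\<lambda>m::int. of_real pi ^ 2 / sin (of_real pi * (z + of_int m * \<tau>)) ^ 2)
           has_sum (wp \<tau> z - 8 * of_real pi ^ 2 * G2 \<tau>)) UNIV"
proof -
  define g :: "int \<Rightarrow> complex" where
    "g = (\<lambda>m. if m = 0 then of_real pi ^ 2 / 3 else of_real pi ^ 2 / sin (of_real pi * (of_int m * \<tau>)) ^ 2)"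
  let ?S = "\<lambda>w. of_real pi ^ 2 / sin (of_real pi * w) ^ 2 :: complex"
  have "((\<lambda>m. ?S (z + of_int m * \<tau>) - g m) has_sum wp \<tau> z) UNIV"
  proof (rule has_sum_Sigma'[where B = "\<lambda>_. UNIV"])
    show "((\<lambda>(m :: int, n :: int). 1 / (z + (of_int m * \<tau> + of_int n)) ^ 2 - 1 / (of_int m * \<tau> + of_int n) ^ 2)
           has_sum wp \<tau> z) (UNIV \<times> UNIV)"
      using wp_has_sum[OF assms(1)] by simp
    fix m :: int
    have 1: "((\<lambda>n::int. 1 / (z + of_int m * \<tau> + of_int n) ^ 2) has_sum ?S (z + of_int m * \<tau>)) UNIV"
      by (rule has_sum_inverse_square_shift period_lattice_not_Int assms)+
    have 2: "((\<lambda>n::int. 1 / (of_int m * \<tau> + of_int n) ^ 2) has_sum g m) UNIV"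
    proof (cases "m = 0")
      case True
      thus ?thesis using has_sum_inverse_square_int by (simp add: g_def)
    next
      case False
      have "of_int m * \<tau> \<notin> \<int>"
        using False assms(1) by (auto elim!: Ints_cases simp: complex_eq_iff)
      from has_sum_inverse_square_shift[OF this] show ?thesis using False by (simp add: g_def)
    qed
    have "((\<lambda>n. 1 / (z + of_int m * \<tau> + of_int n) ^ 2 + - (1 / (of_int m * \<tau> + of_int n) ^ 2))
        has_sum (?S (z + of_int m * \<tau>) + - g m)) UNIV"
      by (intro has_sum_add 1 has_sum_uminusI 2)
    thus "((\<lambda>n. case (m, n) of (m, n) \<Rightarrow> 1 / (z + (of_int m * \<tau> + of_int n)) ^ 2 - 1 / (of_int m * \<tau> + of_int n) ^ 2)
        has_sum (?S (z + of_int m * \<tau>) - g m)) UNIV"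
      by (simp add: add_ac)
  qed
  from has_sum_add[OF this G2_has_sum[OF assms(1)]] show ?thesis
    by (simp add: g_def algebra_simps)
qed

section \<open>The infinite triple product\<close>

text \<open>Dominated convergence for the counting measure, reached by passing from
  \<open>infsum\<close> to \<open>infsetsum\<close>, which is an integral over
  \<open>count_space\<close>.\<close>

lemma tendsto_infsum_dominated:
  fixes F :: "nat \<Rightarrow> 'a \<Rightarrow> complex"
  assumes lim: "\<And>x. x \<in> A \<Longrightarrow> (\<lambda>N. F N x) \<longlonglongrightarrow> G x"
    and bound: "\<And>N x. x \<in> A \<Longrightarrow> norm (F N x) \<le> M x"
    and M: "M summable_on A"
  shows "(\<lambda>N. infsum (F N) A) \<longlonglongrightarrow> infsum G A"
proof -
  have G: "norm (G x) \<le> M x" if "x \<in> A" for x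
    using tendsto_norm[OF lim[OF that]] bound[OF that] by (intro Lim_bounded) auto
  have "(\<lambda>x. norm (M x)) summable_on A"
    using M by (rule iffD1[OF summable_on_iff_abs_summable_on_real])
  hence iM: "integrable (count_space A) M"
    by (simp flip: abs_summable_equivalent add: Infinite_Set_Sum.abs_summable_on_def [symmetric])
  have "(\<lambda>N. infsetsum (F N) A) \<longlonglongrightarrow> infsetsum G A"
    unfolding infsetsum_def using lim bound
    by (intro integral_dominated_convergence[OF _ _ iM]) (auto intro!: AE_I2)
  moreover have "infsetsum (F N) A = infsum (F N) A" for N
    using bound by (intro infsetsum_infsum abs_summable_equivalent[THEN iffD1]
        Infinite_Sum.abs_summable_on_comparison_test'[OF M])
  moreover have "infsetsum G A = infsum G A"
    using G by (intro infsetsum_infsum abs_summable_equivalent[THEN iffD1]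
        Infinite_Sum.abs_summable_on_comparison_test'[OF M])
  ultimately show ?thesis by simp
qed

lemma qpoch_tendsto_nonzero:
  fixes q :: complex
  assumes "norm q < 1"
  obtains P where "P \<noteq> 0" "(\<lambda>n. qpoch q n) \<longlonglongrightarrow> P"
proof -
  have nz: "1 - q ^ Suc i \<noteq> 0" for i
    using qpoch_nonzero[OF assms, of "Suc i"] by (simp add: qpoch_Suc)
  have "summable (\<lambda>i. norm q ^ Suc i)"
    using assms by (subst summable_Suc_iff) (simp add: summable_geometric)
  hence "summable (\<lambda>i. norm ((1 - q ^ Suc i) - 1))"
    by (simp add: norm_mult norm_power)
  hence "convergent_prod (\<lambda>i. 1 - q ^ Suc i)"
    by (intro abs_convergent_prod_imp_convergent_prod) (simp only: abs_convergent_prod_conv_summable)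
  then obtain P where "(\<lambda>n. \<Prod>i\<le>n. 1 - q ^ Suc i) \<longlonglongrightarrow> P" "P \<noteq> 0"
    using convergent_prod_iff_nz_lim[of "\<lambda>i. 1 - q ^ Suc i", OF nz] by blast
  thus ?thesis
    using that LIMSEQ_lessThan_iff_atMost[of "\<lambda>S. \<Prod>i\<in>S. 1 - q ^ Suc i"] unfolding qpoch_def by blast
qed

text \<open>The ratio test in multiplicative form, to be applied to each half of the theta
  series.\<close>

lemma summable_norm_if_ratio_tendsto_0:
  fixes x :: "nat \<Rightarrow> complex"
  assumes step: "\<And>k. x (Suc k) = x k * r k" and "r \<longlonglongrightarrow> 0"
  shows "summable (\<lambda>k. norm (x k))"
proof -
  have "eventually (\<lambda>k. norm (r k) < 1 / 2) sequentially"
    using order_tendstoD(2)[OF tendsto_norm[OF assms(2)], of "1/2"] by simp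
  then obtain N where "norm (r k) < 1 / 2" if "k \<ge> N" for k
    by (auto simp: eventually_sequentially)
  hence "norm (norm (x (Suc k))) \<le> 1 / 2 * norm (norm (x k))" if "k \<ge> N" for k
    using mult_left_mono[of "norm (r k)" "1/2" "norm (x k)"] that unfolding step norm_mult
    by (simp add: less_imp_le)
  thus ?thesis by (intro summable_ratio_test[of "1/2" N]) auto
qed

lemma theta_term_Suc:
  "theta_term \<tau> z (m + 1) = theta_term \<tau> z m * (- epow \<tau> (of_int m) * epow z 1)"
proof -
  have "of_int (m + 1) * (of_int (m + 1) - 1) / 2 = of_int m * (of_int m - 1) / 2 + (of_int m :: complex)"
    by (simp add: field_simps)
  thus ?thesis
    by (simp only: theta_term_def epow_add) (simp add: epow_add power_int_add)
qed

text \<open>Successive ratios are \<open>- q^k y\<close> to the right and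
  \<open>- q^(k+2) y^(-1)\<close> to the left, and both tend to \<open>0\<close>.\<close>

lemma theta_term_abs_summable:
  assumes "Im \<tau> > 0"
  shows "(\<lambda>m. norm (theta_term \<tau> z m)) summable_on UNIV"
proof -
  let ?x = "theta_term \<tau> z"
  have q: "(\<lambda>k. epow \<tau> 1 ^ k) \<longlonglongrightarrow> 0"
    using norm_epow_less_1[OF assms] by (rule LIMSEQ_power_zero)
  have "summable (\<lambda>k. norm (?x (int k)))"
  proof (rule summable_norm_if_ratio_tendsto_0)
    show "?x (int (Suc k)) = ?x (int k) * (- (epow \<tau> 1 ^ k) * epow z 1)" for k
      using theta_term_Suc[of \<tau> z "int k"] by (simp add: epow_power add_ac)
    show "(\<lambda>k. - (epow \<tau> 1 ^ k) * epow z 1) \<longlonglongrightarrow> 0"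
      using tendsto_mult_right[OF tendsto_minus[OF q], of "epow z 1"] by simp
  qed
  moreover have "summable (\<lambda>k. norm (?x (- int (Suc k))))"
  proof (rule summable_norm_if_ratio_tendsto_0)
    fix k
    have "?x (- int (Suc (Suc k)) + 1) = ?x (- int (Suc (Suc k))) * (- epow \<tau> (of_int (- int (Suc (Suc k)))) * epow z 1)"
      by (rule theta_term_Suc)
    moreover have "epow \<tau> (of_int (- int (Suc (Suc k)))) = inverse (epow \<tau> 1 ^ (k + 2))"
      by (simp only: epow_power of_int_minus epow_minus of_int_of_nat_eq) simp
    ultimately show "?x (- int (Suc (Suc k))) = ?x (- int (Suc k)) * (- (epow \<tau> 1 ^ (k + 2)) * inverse (epow z 1))"
      by (simp add: field_simps)
  next
    show "(\<lambda>k. - (epow \<tau> 1 ^ (k + 2)) * inverse (epow z 1)) \<longlonglongrightarrow> 0"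
      using tendsto_mult_right[OF tendsto_minus[OF LIMSEQ_ignore_initial_segment[OF q, of 2]], of "inverse (epow z 1)"]
      by simp
  qed
  ultimately have "(\<lambda>k. norm (?x (int k))) summable_on UNIV" "(\<lambda>k. norm (?x (- int (Suc k)))) summable_on UNIV"
    by (auto intro!: summable_nonneg_imp_summable_on)
  then obtain a b where "((\<lambda>k. norm (?x (int k))) has_sum a) UNIV" "((\<lambda>k. norm (?x (- int (Suc k)))) has_sum b) UNIV"
    unfolding summable_on_def by blast
  from has_sum_int[OF this] show ?thesis unfolding summable_on_def by blast
qed

definition theta_sum :: "complex \<Rightarrow> complex \<Rightarrow> complex" where
  "theta_sum \<tau> z = (\<Sum>\<^sub>\<infinity>m. theta_term \<tau> z m)"

lemma theta_eq_theta_sum: "theta \<tau> z = - epow \<tau> (1 / 8) * epow z (- 1 / 2) * theta_sum \<tau> z"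
proof -
  have "theta \<tau> z = (\<Sum>\<^sub>\<infinity>m. - epow \<tau> (1 / 8) * epow z (- 1 / 2) * theta_term \<tau> z m)"
    unfolding theta_def
  proof (rule infsum_reindex_bij_witness[of _ "\<lambda>m. 2 * m - 1" "\<lambda>n. (n + 1) div 2"])
    fix n :: int assume "n \<in> {n. odd n}"
    then obtain m where n: "n = 2 * m - 1" by (metis mem_Collect_eq oddE diff_add_cancel add.commute
        diff_add_eq distrib_left_numeral mult_2 one_add_one uminus_add_conv_diff add_diff_cancel_left')
    have 1: "(-1 :: complex) powi ((n - 1) div 2) = - ((-1) powi m)"
    proof -
      have "(n - 1) div 2 = m - 1" by (simp add: n)
      thus ?thesis by (simp add: power_int_diff)
    qed
    have 2: "of_int n ^ 2 / 8 = 1 / 8 + of_int m * (of_int m - 1) / (2 :: complex)"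
      by (simp add: n power2_eq_square field_simps)
    have 3: "of_int n / 2 = - 1 / 2 + (of_int m :: complex)" by (simp add: n field_simps)
    have "(n + 1) div 2 = m" by (simp add: n)
    thus "- epow \<tau> (1 / 8) * epow z (- 1 / 2) * theta_term \<tau> z ((n + 1) div 2)
        = (-1) powi ((n - 1) div 2) * epow \<tau> (of_int n ^ 2 / 8) * epow z (of_int n / 2)"
      unfolding 1 2 3 epow_add theta_term_def by simp
  qed (auto, presburger)
  thus ?thesis by (simp only: infsum_cmult_right' theta_sum_def)
qed

text \<open>In the finite triple product the Gaussian binomials stay bounded and tend to
  \<open>P / (P * P)\<close>, where \<open>P\<close> is the infinite product of
  \<open>1 - q^n\<close>; the theta terms dominate.\<close>

lemma qprod_tendsto_theta_sum:
  assumes "Im \<tau> > 0"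
  obtains P where "P \<noteq> 0" "\<And>z. (\<lambda>N. qprod \<tau> N z) \<longlonglongrightarrow> theta_sum \<tau> z / P"
proof -
  define q where "q = epow \<tau> 1"
  have q: "norm q < 1" using norm_epow_less_1[OF assms] by (simp add: q_def)
  obtain P where P: "P \<noteq> 0" "(\<lambda>n. qpoch q n) \<longlonglongrightarrow> P" using qpoch_tendsto_nonzero[OF q] by blast
  obtain B1 where B1: "\<And>n. norm (qpoch q n) \<le> B1"
    using convergent_imp_Bseq[of "qpoch q"] P(2) unfolding Bseq_def convergent_def by auto
  obtain B2 where B2: "\<And>n. norm (inverse (qpoch q n)) \<le> B2"
    using convergent_imp_Bseq[of "\<lambda>n. inverse (qpoch q n)"] tendsto_inverse[OF P(2,1)]
    unfolding Bseq_def convergent_def by auto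
  \<comment> \<open>Extension by \<open>0\<close> puts all the finite sums on the common index set
    of all integers.\<close>
  define c where "c N m = (if \<bar>m\<bar> \<le> int N then qbinom q (2 * N) (nat (m + int N)) else 0)" for N m
  have B0: "B1 \<ge> 0" "B2 \<ge> 0" using B1 B2 norm_ge_zero order_trans by blast+
  have c_bound: "norm (c N m) \<le> B1 * (B2 * B2)" for N m
  proof -
    have "norm (qpoch q a * (inverse (qpoch q b) * inverse (qpoch q d))) \<le> B1 * (B2 * B2)" for a b d
      unfolding norm_mult using B0 by (intro mult_mono B1 B2) auto
    thus ?thesis using B0 by (auto simp: c_def qbinom_def divide_inverse)
  qed
  have c_lim: "(\<lambda>N. c N m) \<longlonglongrightarrow> 1 / P" for m
  proof -
    have l: "(\<lambda>N. qpoch q (f N)) \<longlonglongrightarrow> P" if "filterlim f at_top sequentially" for f :: "nat \<Rightarrow> nat"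
      using filterlim_compose[OF P(2) that] .
    have "(\<lambda>N. qpoch q (2 * N) / (qpoch q (nat (m + int N)) * qpoch q (nat (int N - m)))) \<longlonglongrightarrow> P / (P * P)"
    proof (intro tendsto_intros l)
      show "filterlim (\<lambda>N::nat. 2 * N) at_top sequentially"
        by (rule filterlim_subseq) (auto simp: strict_mono_def)
      have f: "filterlim (\<lambda>N. nat (j + int N)) at_top sequentially" for j
        unfolding filterlim_at_top
      proof
        fix Z
        show "eventually (\<lambda>N. Z \<le> nat (j + int N)) sequentially"
          using eventually_ge_at_top[of "nat \<bar>j\<bar> + Z"] by eventually_elim linarith
      qed
      show "filterlim (\<lambda>N. nat (m + int N)) at_top sequentially" by (rule f)
      show "filterlim (\<lambda>N. nat (int N - m)) at_top sequentially" using f[of "- m"] by simp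
    qed (use P in auto)
    moreover have "eventually (\<lambda>N. qpoch q (2 * N) / (qpoch q (nat (m + int N)) * qpoch q (nat (int N - m))) = c N m) sequentially"
      using eventually_ge_at_top[of "nat \<bar>m\<bar>"]
    proof eventually_elim
      case (elim N)
      hence "2 * N - nat (m + int N) = nat (int N - m)" "nat (m + int N) \<le> 2 * N" "\<bar>m\<bar> \<le> int N" by auto
      thus ?case by (simp add: c_def qbinom_def)
    qed
    ultimately show ?thesis using P(1) by (auto elim: Lim_transform_eventually)
  qed
  have lim: "(\<lambda>N. qprod \<tau> N z) \<longlonglongrightarrow> theta_sum \<tau> z / P" for z
  proof -
    have "qprod \<tau> N z = (\<Sum>\<^sub>\<infinity>m. c N m * theta_term \<tau> z m)" for N
    proof -
      have "(\<Sum>\<^sub>\<infinity>m. c N m * theta_term \<tau> z m) = (\<Sum>\<^sub>\<infinity>m\<in>{- int N..int N}. c N m * theta_term \<tau> z m)"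
        by (rule infsum_cong_neutral) (auto simp: c_def)
      also have "\<dots> = (\<Sum>m\<in>{- int N..int N}. c N m * theta_term \<tau> z m)" by simp
      also have "\<dots> = (\<Sum>k\<le>2*N. qbinom q (2*N) k * theta_term \<tau> z (int k - int N))"
        by (rule sum.reindex_bij_witness[of _ "\<lambda>k. int k - int N" "\<lambda>m. nat (m + int N)"]) (auto simp: c_def)
      finally show ?thesis using finite_triple_product[OF assms] by (simp add: q_def)
    qed
    moreover have "(\<lambda>N. \<Sum>\<^sub>\<infinity>m. c N m * theta_term \<tau> z m) \<longlonglongrightarrow> (\<Sum>\<^sub>\<infinity>m. 1 / P * theta_term \<tau> z m)"
    proof (rule tendsto_infsum_dominated)
      show "(\<lambda>m. B1 * (B2 * B2) * norm (theta_term \<tau> z m)) summable_on UNIV"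
        by (intro summable_on_cmult_right theta_term_abs_summable assms)
    qed (auto intro!: tendsto_intros c_lim mult_right_mono c_bound simp: norm_mult simp del: times_divide_eq_left)
    ultimately have "(\<lambda>N. qprod \<tau> N z) \<longlonglongrightarrow> 1 / P * theta_sum \<tau> z"
      by (simp add: infsum_cmult_right' theta_sum_def del: times_divide_eq_left)
    thus ?thesis by simp
  qed
  show ?thesis using that[OF P(1) lim] .
qed

section \<open>The logarithmic derivative of theta\<close>

text \<open>The second derivative of \<open>log f\<close>, spelled out in derivatives of
  \<open>f\<close> so that no branch of the logarithm is chosen and limits can be taken in each
  ingredient.\<close>

definition logderiv2 :: "(complex \<Rightarrow> complex) \<Rightarrow> complex \<Rightarrow> complex" where
  "logderiv2 f z = (deriv (deriv f) z * f z - deriv f z ^ 2) / f z ^ 2"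

lemma has_field_derivative_logderiv:
  assumes "f holomorphic_on UNIV" "f z \<noteq> 0"
  shows "((\<lambda>w. deriv f w / f w) has_field_derivative logderiv2 f z) (at z)"
proof -
  have "(f has_field_derivative deriv f z) (at z)"
    using assms(1) by (auto intro: holomorphic_derivI)
  moreover have "(deriv f has_field_derivative deriv (deriv f) z) (at z)"
    using holomorphic_deriv[OF assms(1)] by (auto intro: holomorphic_derivI)
  ultimately show ?thesis
    using assms(2) by (auto intro!: derivative_eq_intros simp: logderiv2_def power2_eq_square)
qed

lemma logderiv2_mult:
  assumes f: "f holomorphic_on UNIV" and g: "g holomorphic_on UNIV" and nz: "f z \<noteq> 0" "g z \<noteq> 0"
  shows "logderiv2 (\<lambda>w. f w * g w) z = logderiv2 f z + logderiv2 g z"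
proof -
  have fd: "f field_differentiable at w" "g field_differentiable at w"
    "deriv f field_differentiable at w" "deriv g field_differentiable at w" for w
    using f g holomorphic_deriv[OF f] holomorphic_deriv[OF g] by (auto simp: holomorphic_on_def)
  have 1: "deriv (\<lambda>w. f w * g w) = (\<lambda>w. f w * deriv g w + deriv f w * g w)"
    by (simp add: fd fun_eq_iff)
  have "deriv (deriv (\<lambda>w. f w * g w)) z = f z * deriv (deriv g) z + deriv f z * deriv g z +
      (deriv f z * deriv g z + deriv (deriv f) z * g z)"
    unfolding 1 by (simp add: fd field_differentiable_mult)
  thus ?thesis
    using nz unfolding logderiv2_def 1 by (simp add: field_simps power2_eq_square)
qed

lemma logderiv2_prod:
  assumes "\<And>i. i \<in> I \<Longrightarrow> f i holomorphic_on UNIV" "\<And>i. i \<in> I \<Longrightarrow> f i z \<noteq> 0"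
  shows "logderiv2 (\<lambda>w. \<Prod>i\<in>I. f i w) z = (\<Sum>i\<in>I. logderiv2 (f i) z)"
  using assms
proof (induction I rule: infinite_finite_induct)
  case (insert i I)
  thus ?case by (simp add: logderiv2_mult holomorphic_on_prod)
qed (simp_all add: logderiv2_def)

section \<open>Logarithmic derivatives of the partial products\<close>

lemma has_field_derivative_epow:
  "((\<lambda>w. epow w a) has_field_derivative 2 * of_real pi * \<i> * a * epow z a) (at z within S)"
  unfolding epow_def by (auto intro!: derivative_eq_intros)

lemma deriv_epow: "deriv (\<lambda>w. c * epow w a) = (\<lambda>w. c * (2 * of_real pi * \<i> * a) * epow w a)"
  by (auto intro!: DERIV_imp_deriv derivative_eq_intros has_field_derivative_epow simp: fun_eq_iff)

lemma deriv_one_minus_epow: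
  "deriv (\<lambda>w. 1 - c * epow w a) = (\<lambda>w. (- c * (2 * of_real pi * \<i> * a)) * epow w a)"
  by (auto intro!: DERIV_imp_deriv derivative_eq_intros has_field_derivative_epow simp: fun_eq_iff)

lemma holomorphic_epow [holomorphic_intros]: "(\<lambda>w. epow w a) holomorphic_on A"
  unfolding epow_def by (intro holomorphic_intros)

text \<open>The logarithm of an exponential is linear in \<open>w\<close>, so the prefactor
  \<open>y^(-1/2)\<close> of theta contributes nothing.\<close>

lemma logderiv2_epow:
  assumes "c \<noteq> 0"
  shows "logderiv2 (\<lambda>w. c * epow w a) z = 0"
  unfolding logderiv2_def deriv_epow by (simp add: power2_eq_square)

lemma logderiv2_one_minus_epow:
  assumes "c * epow z a \<noteq> 1"
  shows "logderiv2 (\<lambda>w. 1 - c * epow w a) z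
     = 4 * of_real pi ^ 2 * a ^ 2 * (c * epow z a) / (1 - c * epow z a) ^ 2"
  using assms unfolding logderiv2_def deriv_one_minus_epow deriv_epow
  by (simp add: power2_eq_square algebra_simps)

abbreviation csc_square :: "complex \<Rightarrow> complex" where
  "csc_square w \<equiv> of_real pi ^ 2 / sin (of_real pi * w) ^ 2"

lemma csc_square_minus: "csc_square (- w) = csc_square w"
  by simp

text \<open>Powers of \<open>q\<close> become shifts of \<open>z\<close> by multiples of \<tau>. The
  outer minus sign in the second equation disappears later because \<open>csc_square\<close> is
  even.\<close>

lemma epow_shift:
  "epow \<tau> a * epow z 1 = epow (z + a * \<tau>) 1" "epow \<tau> a * epow z (- 1) = epow (- (z + - a * \<tau>)) 1"
  by (simp_all add: epow_def algebra_simps flip: exp_add)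

lemma epow_shift_neq_1:
  assumes "z \<notin> period_lattice \<tau>"
  shows "epow \<tau> (of_nat n) * epow z 1 \<noteq> 1" "epow \<tau> (of_nat n) * epow z (- 1) \<noteq> 1"
  unfolding epow_shift epow_eq_1_iff minus_in_Ints_iff
  using period_lattice_not_Int[OF assms, of "int n"] period_lattice_not_Int[OF assms, of "- int n"]
  by simp_all

lemma qprod_holomorphic: "qprod \<tau> N holomorphic_on A"
  unfolding qprod_def by (intro holomorphic_intros)

lemma sum_int_symmetric:
  fixes f :: "int \<Rightarrow> 'a :: comm_monoid_add"
  shows "(\<Sum>m\<in>{- int N..<int N}. f m) = (\<Sum>j<N. f (int j) + f (- int (Suc j)))"
proof (induction N)
  case (Suc N)
  have "{- int (Suc N)..<int (Suc N)} = insert (int N) (insert (- int (Suc N)) {- int N..<int N})" by auto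
  thus ?case using Suc by (simp add: add_ac)
qed simp

text \<open>The first factor at \<open>j\<close> yields row \<open>j\<close>, the second, with
  exponent \<open>j + 1\<close>, yields row \<open>-(j + 1)\<close>; hence the half-open range of
  rows.\<close>

lemma logderiv2_qprod:
  assumes "z \<notin> period_lattice \<tau>"
  shows "logderiv2 (qprod \<tau> N) z = - (\<Sum>m\<in>{- int N..<int N}. csc_square (z + of_int m * \<tau>))"
proof -
  let ?f = "\<lambda>j w. 1 - epow \<tau> (of_nat j) * epow w 1" and ?g = "\<lambda>j w. 1 - epow \<tau> (of_nat j) * epow w (- 1)"
  have nz: "?f j z \<noteq> 0" "?g j z \<noteq> 0" for j using epow_shift_neq_1[OF assms, of j] by auto
  have holo: "?f j holomorphic_on UNIV" "?g j holomorphic_on UNIV" for j by (intro holomorphic_intros)+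
  have f: "logderiv2 (?f j) z = - csc_square (z + of_int (int j) * \<tau>)" for j
    unfolding logderiv2_one_minus_epow[OF epow_shift_neq_1(1)[OF assms]]
    unfolding epow_shift pi_square_over_sin_square by simp
  have g: "logderiv2 (?g j) z = - csc_square (z + of_int (- int j) * \<tau>)" for j
  proof -
    have "logderiv2 (?g j) z = - csc_square (- (z + of_int (- int j) * \<tau>))"
      unfolding logderiv2_one_minus_epow[OF epow_shift_neq_1(2)[OF assms]]
      unfolding epow_shift pi_square_over_sin_square by simp
    thus ?thesis by (simp only: csc_square_minus)
  qed
  have "qprod \<tau> N = (\<lambda>w. \<Prod>j<N. ?f j w * ?g (Suc j) w)"
    by (simp add: fun_eq_iff qprod_def)
  hence "logderiv2 (qprod \<tau> N) z = (\<Sum>j<N. logderiv2 (\<lambda>w. ?f j w * ?g (Suc j) w) z)"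
    using nz holo by (simp only:) (intro logderiv2_prod holomorphic_on_mult; simp del: of_nat_Suc)
  also have "\<dots> = (\<Sum>j<N. - (csc_square (z + of_int (int j) * \<tau>) + csc_square (z + of_int (- int (Suc j)) * \<tau>)))"
    by (intro sum.cong refl) (simp only: logderiv2_mult[OF holo nz] f g minus_add_distrib)
  finally show ?thesis
    by (simp only: sum_int_symmetric sum_negf)
qed

text \<open>An unconditional sum is the limit along any exhausting sequence of finite sets,
  including these lopsided intervals.\<close>

lemma sum_int_tendsto:
  assumes "(f has_sum s) (UNIV :: int set)"
  shows "(\<lambda>N. \<Sum>m\<in>{- int N..<int N}. f m) \<longlonglongrightarrow> s"
proof -
  have "filterlim (\<lambda>N. {- int N..<int N}) (finite_subsets_at_top UNIV) sequentially"
    unfolding filterlim_finite_subsets_at_top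
  proof safe
    fix X :: "int set" assume "finite X"
    then obtain K where "\<forall>n\<in>(\<lambda>x. nat \<bar>x\<bar>) ` X. n < K"
      using finite_nat_set_iff_bounded by blast
    hence K: "\<bar>x\<bar> < int K" if "x \<in> X" for x using that by force
    show "eventually (\<lambda>N. finite {- int N..<int N} \<and> X \<subseteq> {- int N..<int N} \<and> {- int N..<int N} \<subseteq> UNIV) sequentially"
      using eventually_ge_at_top[of K] by eventually_elim (use K in \<open>force dest: K\<close>)
  qed
  thus ?thesis using assms unfolding has_sum_def by (rule filterlim_compose[rotated])
qed

lemma qprod_uniformly_convergent:
  assumes "Im \<tau> > 0"
  shows "uniformly_convergent_on (cball z0 1) (qprod \<tau>)"
proof -
  define q where "q = epow \<tau> 1"
  have q: "norm q < 1" using norm_epow_less_1[OF assms] by (simp add: q_def)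
  \<comment> \<open>Bounds both \<open>y\<close> and \<open>y^(-1)\<close> on the ball, where the
    imaginary part is at most \<open>norm z0 + 1\<close> in absolute value.\<close>
  define B where "B = exp (2 * pi * (norm z0 + 1))"
  have B: "norm (epow w 1) \<le> B" "norm (epow w (- 1)) \<le> B" if "w \<in> cball z0 1" for w
  proof -
    have "norm w \<le> norm z0 + 1" using that norm_triangle_ineq2[of w z0] by (simp add: dist_norm norm_minus_commute)
    hence "\<bar>Im w\<bar> \<le> norm z0 + 1" using abs_Im_le_cmod[of w] by linarith
    hence "2 * pi * \<bar>Im w\<bar> \<le> 2 * pi * (norm z0 + 1)" by (intro mult_left_mono) auto
    moreover have "\<bar>2 * pi * Im w\<bar> = 2 * pi * \<bar>Im w\<bar>" by (simp add: abs_mult)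
    ultimately have "- (2 * pi * Im w) \<le> 2 * pi * (norm z0 + 1)" "2 * pi * Im w \<le> 2 * pi * (norm z0 + 1)"
      by linarith+
    thus "norm (epow w 1) \<le> B" "norm (epow w (- 1)) \<le> B"
      by (simp_all add: B_def epow_def norm_exp_eq_Re)
  qed
  define u where "u j w = (1 - epow \<tau> (of_nat j) * epow w 1) * (1 - epow \<tau> (of_nat (Suc j)) * epow w (- 1)) - 1"
    for j w
  have u: "norm (u j w) \<le> (2 * B + 1) * norm q ^ j" if w: "w \<in> cball z0 1" for j w
  proof -
    let ?a = "q ^ j * epow w 1" and ?b = "q ^ Suc j * epow w (- 1)"
    have r: "norm q ^ Suc j \<le> norm q ^ j" "norm q ^ (j + Suc j) \<le> norm q ^ j"
      using power_decreasing[of j "Suc j" "norm q"] power_decreasing[of j "j + Suc j" "norm q"] q by auto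
    have ab: "?a * ?b = q ^ (j + Suc j)" by (simp add: epow_minus power_add)
    \<comment> \<open>The factors \<open>y\<close> and \<open>y^(-1)\<close> cancel in the cross
      term, so every term left is of order \<open>q^j\<close>.\<close>
    have "u j w = q ^ (j + Suc j) - ?a - ?b"
      unfolding u_def epow_of_nat [of \<tau>] q_def [symmetric] ab [symmetric] by algebra
    also have "norm \<dots> \<le> norm (q ^ (j + Suc j)) + norm ?a + norm ?b"
      by (intro order_trans[OF norm_triangle_ineq4] add_right_mono norm_triangle_ineq4)
    also have "\<dots> \<le> norm q ^ j + norm q ^ j * B + norm q ^ j * B"
      unfolding norm_mult norm_power using r B[OF w] by (intro add_mono mult_mono) auto
    finally show ?thesis by (simp add: algebra_simps)
  qed
  have "uniformly_convergent_on (cball z0 1) (\<lambda>N w. \<Sum>j<N. norm (u j w))"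
  proof (rule Weierstrass_m_test')
    show "norm (norm (u j w)) \<le> (2 * B + 1) * norm q ^ j" if "w \<in> cball z0 1" for j w
      using u[OF that] by simp
    show "summable (\<lambda>j. (2 * B + 1) * norm q ^ j)"
      using q by (intro summable_mult summable_geometric) simp
  qed
  hence "uniformly_convergent_on (cball z0 1) (\<lambda>N w. \<Prod>j<N. 1 + u j w)"
    unfolding u_def
    by (intro uniformly_convergent_on_prod holomorphic_on_imp_continuous_on holomorphic_intros) auto
  thus ?thesis by (simp add: u_def qprod_def [abs_def])
qed

text \<open>Off the lattice no factor vanishes, and an absolutely convergent product without zero
  factors has a nonzero limit.\<close>

lemma qprod_limit_nonzero:
  assumes "Im \<tau> > 0" "z \<notin> period_lattice \<tau>" "(\<lambda>N. qprod \<tau> N z) \<longlonglongrightarrow> L"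
  shows "L \<noteq> 0"
proof -
  let ?a = "\<lambda>j. 1 - epow \<tau> (of_nat j) * epow z 1" and ?b = "\<lambda>j. 1 - epow \<tau> (of_nat (Suc j)) * epow z (- 1)"
  have conv: "convergent_prod (\<lambda>j. 1 - c * epow \<tau> 1 ^ j)" for c :: complex
  proof (rule abs_convergent_prod_imp_convergent_prod)
    have "summable (\<lambda>j. norm c * norm (epow \<tau> 1) ^ j)"
      using norm_epow_less_1[OF assms(1)] by (intro summable_mult summable_geometric) simp
    thus "abs_convergent_prod (\<lambda>j. 1 - c * epow \<tau> 1 ^ j)"
      by (simp add: abs_convergent_prod_conv_summable norm_mult norm_power)
  qed
  have "convergent_prod ?a" "convergent_prod ?b"
    using conv[of "epow z 1"] conv[of "epow \<tau> 1 * epow z (- 1)"]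
    by (simp_all only: epow_of_nat [of \<tau>] power_Suc mult_ac)
  hence c: "convergent_prod (\<lambda>j. ?a j * ?b j)" by (rule convergent_prod_mult)
  have nz: "?a j * ?b j \<noteq> 0" for j
    using epow_shift_neq_1[OF assms(2)] by (simp del: of_nat_Suc)
  obtain L' where "(\<lambda>n. \<Prod>j\<le>n. ?a j * ?b j) \<longlonglongrightarrow> L'" "L' \<noteq> 0"
    using c convergent_prod_iff_nz_lim[of "\<lambda>j. ?a j * ?b j", OF nz] by blast
  moreover have "(\<lambda>n. \<Prod>j\<le>n. ?a j * ?b j) \<longlonglongrightarrow> L"
    using assms(3) LIMSEQ_lessThan_iff_atMost[of "\<lambda>S. \<Prod>j\<in>S. ?a j * ?b j"]
    unfolding qprod_def by blast
  ultimately show ?thesis using LIMSEQ_unique by blast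
qed

text \<open>All three facts come from the locally uniform limit \<open>Q\<close> of
  \<open>qprod\<close>, which differs from theta by a nonvanishing exponential factor.\<close>

lemma
  assumes "Im \<tau> > 0"
  shows theta_holomorphic: "theta \<tau> holomorphic_on UNIV"
    and theta_nonzero: "z \<notin> period_lattice \<tau> \<Longrightarrow> theta \<tau> z \<noteq> 0"
    and logderiv2_theta: "z \<notin> period_lattice \<tau> \<Longrightarrow> logderiv2 (theta \<tau>) z = 8 * of_real pi ^ 2 * G2 \<tau> - wp \<tau> z"
proof -
  obtain P where P: "P \<noteq> 0" "\<And>z. (\<lambda>N. qprod \<tau> N z) \<longlonglongrightarrow> theta_sum \<tau> z / P"
    using qprod_tendsto_theta_sum[OF assms] by blast
  define Q where "Q z = theta_sum \<tau> z / P" for z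
  have ul: "uniform_limit (cball z0 1) (qprod \<tau>) Q sequentially" for z0
  proof -
    obtain l where l: "uniform_limit (cball z0 1) (qprod \<tau>) l sequentially"
      using qprod_uniformly_convergent[OF assms] unfolding uniformly_convergent_on_def by blast
    have "l w = Q w" if "w \<in> cball z0 1" for w
      using tendsto_uniform_limitI[OF l that] P(2)[of w] unfolding Q_def by (rule LIMSEQ_unique)
    with l show ?thesis by (subst uniform_limit_cong'[of _ _ "qprod \<tau>" Q l]) auto
  qed
  have Q: "Q holomorphic_on UNIV"
    by (rule holomorphic_uniform_sequence[OF open_UNIV qprod_holomorphic])
      (auto intro!: exI[of _ 1] ul)
  define c where "c = - epow \<tau> (1 / 8) * P"
  have c: "c \<noteq> 0" using P by (simp add: c_def)
  have theta: "theta \<tau> = (\<lambda>w. c * epow w (- 1 / 2) * Q w)"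
    using P(1) by (simp add: theta_eq_theta_sum fun_eq_iff c_def Q_def)
  show "theta \<tau> holomorphic_on UNIV"
    unfolding theta by (intro holomorphic_intros Q)
  assume z: "z \<notin> period_lattice \<tau>"
  have Qnz: "Q z \<noteq> 0"
    using qprod_limit_nonzero[OF assms z] P(2) unfolding Q_def by blast
  show "theta \<tau> z \<noteq> 0" using Qnz c by (simp add: theta)
  \<comment> \<open>Uniform convergence of holomorphic functions carries over to derivatives;
    \<open>k = 0, 1, 2\<close> are the orders that enter \<open>logderiv2\<close>.\<close>
  have d: "(\<lambda>N. (deriv ^^ k) (qprod \<tau> N) z) \<longlonglongrightarrow> (deriv ^^ k) Q z" for k
  proof (rule higher_deriv_complex_uniform_limit)
    show "uniform_limit (ball z 1) (qprod \<tau>) Q sequentially"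
      using ul[of z] by (rule uniform_limit_on_subset) auto
  qed (auto intro!: always_eventually qprod_holomorphic)
  have "(\<lambda>N. logderiv2 (qprod \<tau> N) z) \<longlonglongrightarrow> logderiv2 Q z"
    unfolding logderiv2_def using d[of 0] d[of 1] d[of 2] Qnz
    by (intro tendsto_intros) (simp_all add: numeral_2_eq_2)
  moreover have "(\<lambda>N. logderiv2 (qprod \<tau> N) z) \<longlonglongrightarrow> - (wp \<tau> z - 8 * of_real pi ^ 2 * G2 \<tau>)"
    unfolding logderiv2_qprod[OF z] by (intro tendsto_minus sum_int_tendsto wp_row_sum assms z)
  ultimately have "logderiv2 Q z = - (wp \<tau> z - 8 * of_real pi ^ 2 * G2 \<tau>)"
    by (rule LIMSEQ_unique)
  moreover have "logderiv2 (theta \<tau>) z = logderiv2 (\<lambda>w. c * epow w (- 1 / 2)) z + logderiv2 Q z"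
    unfolding theta using c Q Qnz by (intro logderiv2_mult holomorphic_intros) auto
  ultimately show "logderiv2 (theta \<tau>) z = 8 * of_real pi ^ 2 * G2 \<tau> - wp \<tau> z"
    using logderiv2_epow[OF c] by simp
qed

section \<open>Comparison of the power series\<close>

text \<open>The coordinate bound leaves only finitely many lattice points in a ball. This makes the
  identity for \<open>logderiv2\<close> an identity of germs at \<open>z\<close>.\<close>

lemma eventually_not_in_period_lattice:
  assumes "Im \<tau> > 0" "z \<notin> period_lattice \<tau>"
  shows "eventually (\<lambda>w. w \<notin> period_lattice \<tau>) (nhds z)"
proof -
  obtain M where M0: "M > 0" and M: "\<And>x y. \<bar>x\<bar> + \<bar>y\<bar> \<le> M * norm (of_real x * \<tau> + of_real y)"
    using lattice_norm_lower_bound[OF assms(1)] by blast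
  define F where "F = period_lattice \<tau> \<inter> ball z 1"
  define B where "B = \<lceil>M * (norm z + 1)\<rceil>"
  have "F \<subseteq> (\<lambda>(m, n). of_int m * \<tau> + of_int n) ` ({- B..B} \<times> {- B..B})"
  proof
    fix w assume w: "w \<in> F"
    then obtain m n :: int where mn: "w = of_int m * \<tau> + of_int n" unfolding F_def period_lattice_def by auto
    have "norm w \<le> norm z + 1"
      using w norm_triangle_ineq2[of w z] by (simp add: F_def dist_norm norm_minus_commute)
    hence "M * norm w \<le> M * (norm z + 1)" using M0 by simp
    with M[of "of_int m" "of_int n"] have "\<bar>real_of_int m\<bar> + \<bar>real_of_int n\<bar> \<le> of_int B"
      unfolding mn B_def by simp linarith
    hence "(m, n) \<in> {- B..B} \<times> {- B..B}" by auto
    thus "w \<in> (\<lambda>(m, n). of_int m * \<tau> + of_int n) ` ({- B..B} \<times> {- B..B})"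
      unfolding mn by (rule rev_image_eqI) simp
  qed
  hence "finite F" by (rule finite_subset) auto
  hence "eventually (\<lambda>w. w \<in> ball z 1 - F) (nhds z)"
    using assms(2) by (intro eventually_nhds_in_open open_Diff finite_imp_closed) (auto simp: F_def)
  thus ?thesis by eventually_elim (auto simp: F_def)
qed

text \<open>The equation determines \<open>n + 1\<close> times the next coefficient of
  \<open>F - G\<close> from the lower ones, and \<open>n + 1\<close> is cancelled in characteristic
  zero.\<close>

lemma fps_linear_ode_unique:
  fixes F G :: "'a :: field_char_0 fps"
  assumes "fps_deriv F = C * F" "fps_deriv G = C * G" "fps_nth F 0 = fps_nth G 0"
  shows "F = G"
proof -
  have "fps_nth (F - G) n = 0" for n
  proof (induction n rule: less_induct)
    case (less n)
    show ?case
    proof (cases n)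
      case (Suc k)
      have "of_nat (Suc k) * fps_nth (F - G) (Suc k) = fps_nth (fps_deriv (F - G)) k"
        by (simp add: algebra_simps)
      also have "fps_deriv (F - G) = C * (F - G)" using assms by (simp add: algebra_simps)
      also have "fps_nth (C * (F - G)) k = 0"
        unfolding fps_mult_nth using less Suc by (intro sum.neutral) auto
      finally show ?thesis using Suc by (simp del: of_nat_Suc)
    qed (use assms in simp)
  qed
  thus ?thesis by (simp add: fps_eq_iff)
qed

lemma fps_deriv_fps_exp_of:
  assumes "fps_nth F 0 = 0"
  shows "fps_deriv (fps_exp_of F) = fps_deriv F * fps_exp_of F"
  using fps_compose_deriv[OF assms, of "fps_exp 1"] by (simp add: fps_exp_of_def mult.commute)

lemma fps_exp_of_nth_0 [simp]: "fps_nth (fps_exp_of F) 0 = 1"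
  by (simp add: fps_exp_of_def)

theorem proposition1p4:
  fixes \<tau> z :: complex
  assumes "Im \<tau> > 0"
    and "z \<notin> period_lattice \<tau>"
  shows "fps_exp_of (- fps_const (4 * of_real pi ^ 2 * G2 \<tau>) * fps_X ^ 2
                     - fps_const (theta_z \<tau> z / theta \<tau> z) * fps_X)
           * fps_expansion (\<lambda>\<xi>. theta \<tau> (z + \<xi>)) 0
         = fps_const (theta \<tau> z)
           * fps_exp_of (- Abs_fps (\<lambda>n. if n \<ge> 2 then (deriv ^^ (n - 2)) (wp \<tau>) z / fact n else 0))"
proof -
  define c where "c = 8 * of_real pi ^ 2 * G2 \<tau>"
  define A where "A = - fps_const (4 * of_real pi ^ 2 * G2 \<tau>) * fps_X ^ 2
                     - fps_const (theta_z \<tau> z / theta \<tau> z) * fps_X"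
  define B where "B = - Abs_fps (\<lambda>n. if n \<ge> 2 then (deriv ^^ (n - 2)) (wp \<tau>) z / fact n else 0)"
  define \<Theta> where "\<Theta> = fps_expansion (\<lambda>\<xi>. theta \<tau> (z + \<xi>)) 0"
  \<comment> \<open>The expansion of the logarithmic derivative of theta at \<open>z\<close>; the
    quotient is genuine since \<Theta> has the nonzero constant term
    \<open>theta \<tau> z\<close>.\<close>
  define E where "E = fps_deriv \<Theta> / \<Theta>"
  note holo = theta_holomorphic[OF assms(1)]
  have nz: "theta \<tau> z \<noteq> 0" by (rule theta_nonzero[OF assms])
  have fd: "(theta \<tau> has_field_derivative deriv (theta \<tau>) w) (at w)" for w
    using holo by (auto intro: holomorphic_derivI)
  have T: "(\<lambda>\<xi>. theta \<tau> (z + \<xi>)) has_fps_expansion \<Theta>"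
    unfolding \<Theta>_def
    by (rule has_fps_expansion_fps_expansion[of UNIV])
      (auto intro!: holomorphic_on_compose_gen[OF _ holo, unfolded o_def] holomorphic_intros)
  have T0: "fps_nth \<Theta> 0 = theta \<tau> z" by (simp add: \<Theta>_def fps_expansion_def)
  have "deriv (\<lambda>\<xi>. theta \<tau> (z + \<xi>)) = (\<lambda>\<xi>. deriv (theta \<tau>) (z + \<xi>))"
  proof
    fix \<xi> show "deriv (\<lambda>\<xi>. theta \<tau> (z + \<xi>)) \<xi> = deriv (theta \<tau>) (z + \<xi>)"
      using fd[of "\<xi> + z"] by (intro DERIV_imp_deriv) (simp add: DERIV_shift add.commute[of z])
  qed
  with has_fps_expansion_deriv[OF T] have T': "(\<lambda>\<xi>. deriv (theta \<tau>) (z + \<xi>)) has_fps_expansion fps_deriv \<Theta>"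
    by simp
  have Eexp: "(\<lambda>\<xi>. deriv (theta \<tau>) (z + \<xi>) / theta \<tau> (z + \<xi>)) has_fps_expansion E"
    unfolding E_def using T' T nz T0 by (intro has_fps_expansion_divide') auto
  have E\<Theta>: "fps_deriv \<Theta> = E * \<Theta>"
    using nz T0 by (simp add: E_def fps_divide_unit mult.assoc inverse_mult_eq_1)
  have E0: "fps_nth E 0 = theta_z \<tau> z / theta \<tau> z"
    using has_fps_expansion_imp_0_eq_fps_nth_0[OF Eexp] by (simp add: theta_z_def)
  have "eventually (\<lambda>\<xi>. z + \<xi> \<notin> period_lattice \<tau>) (nhds 0)"
    using eventually_not_in_period_lattice[OF assms] by (simp add: nhds_to_0[of z] eventually_filtermap add_ac)
  hence ev: "eventually (\<lambda>\<xi>. c - deriv (\<lambda>\<xi>. deriv (theta \<tau>) (z + \<xi>) / theta \<tau> (z + \<xi>)) \<xi> = wp \<tau> (z + \<xi>)) (nhds 0)"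
  proof eventually_elim
    case (elim \<xi>)
    have "((\<lambda>\<xi>. deriv (theta \<tau>) (z + \<xi>) / theta \<tau> (z + \<xi>)) has_field_derivative logderiv2 (theta \<tau>) (z + \<xi>)) (at \<xi>)"
      using has_field_derivative_logderiv[OF holo theta_nonzero[OF assms(1) elim]]
      by (simp add: DERIV_shift add.commute[of z])
    thus ?case using logderiv2_theta[OF assms(1) elim] by (simp add: DERIV_imp_deriv c_def)
  qed
  have "(\<lambda>\<xi>. c - deriv (\<lambda>\<xi>. deriv (theta \<tau>) (z + \<xi>) / theta \<tau> (z + \<xi>)) \<xi>) has_fps_expansion fps_const c - fps_deriv E"
    by (intro fps_expansion_intros Eexp)
  hence W: "(\<lambda>\<xi>. wp \<tau> (z + \<xi>)) has_fps_expansion fps_const c - fps_deriv E"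
    using has_fps_expansion_cong[OF ev HOL.refl] by simp
  have W': "fps_nth (fps_const c - fps_deriv E) n = (deriv ^^ n) (wp \<tau>) z / fact n" for n
    using fps_nth_fps_expansion[OF W, of n] higher_deriv_shift_0[of n "wp \<tau>" z] by (simp add: o_def)
  have "fps_nth (fps_deriv (fps_deriv B)) n = - fps_nth (fps_const c - fps_deriv E) n" for n
  proof -
    have "(fact (Suc (Suc n)) :: complex) = of_nat (Suc (Suc n)) * (of_nat (Suc n) * fact n)"
      by (simp only: fact_Suc)
    thus ?thesis unfolding W' by (simp add: B_def del: of_nat_Suc fact_Suc)
  qed
  hence B'': "fps_deriv (fps_deriv B) = fps_deriv E - fps_const c"
    by (simp add: fps_eq_iff)
  have A'': "fps_deriv (fps_deriv A) = - fps_const c"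
    by (simp add: A_def c_def fps_eq_iff power2_eq_square fps_numeral_nth)
  \<comment> \<open>This is the identity for the second logarithmic derivative, read off in power
    series. One integration remains.\<close>
  have "fps_deriv (fps_deriv B - fps_deriv A) = fps_deriv E" by (simp add: A'' B'')
  hence "fps_deriv B - fps_deriv A = fps_const (fps_nth (fps_deriv B - fps_deriv A) 0 - fps_nth E 0) + E"
    by (rule iffD1[OF fps_deriv_eq_iff])
  \<comment> \<open>The integration constant vanishes: \<open>B\<close> has no linear term, and that
    of \<open>A\<close> is minus the logarithmic derivative at \<open>z\<close>.\<close>
  moreover have "fps_nth (fps_deriv B - fps_deriv A) 0 = fps_nth E 0"
    by (simp add: A_def B_def E0 power2_eq_square)
  ultimately have E: "fps_deriv B - fps_deriv A = E"
    by (simp only: diff_self fps_const_0_eq_0 add_0)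
  have AB0: "fps_nth A 0 = 0" "fps_nth B 0 = 0" by (simp_all add: A_def B_def)
  have "fps_exp_of A * \<Theta> = fps_const (theta \<tau> z) * fps_exp_of B"
  \<comment> \<open>Both sides solve \<open>F' = B' F\<close>; on the left, the coefficient is
    \<open>A' + E = B'\<close>.\<close>
  proof (rule fps_linear_ode_unique)
    show "fps_deriv (fps_exp_of A * \<Theta>) = fps_deriv B * (fps_exp_of A * \<Theta>)"
      by (simp add: fps_deriv_fps_exp_of AB0 E\<Theta> E [symmetric] algebra_simps)
    show "fps_deriv (fps_const (theta \<tau> z) * fps_exp_of B) = fps_deriv B * (fps_const (theta \<tau> z) * fps_exp_of B)"
      by (simp add: fps_deriv_fps_exp_of AB0 algebra_simps)
  qed (simp add: T0)
  thus ?thesis by (simp only: A_def B_def \<Theta>_def)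
qed

end
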